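(* Let $r\ge 2$ be an integer and let $H$ be a finite hypergraph (multiple edges allowed) in which every edge has at most $r$ vertices and no edge of $H$ consists of a twin set. Then there is a weighting $\rho: E(H)\to \{1,2,\ldots,\max\{5,r+1\}\}$ such that the induced vertex weights $\rho(v):=\sum_{e\in E(H),\, e\ni v}\rho(e)$, $v\in V(H)$, properly color $V(H)$.
   Context: A hypergraph $H$ consists of a vertex set $V(H)$ and a collection $E(H)$ of subsets of $V(H)$, called edges; multiple edges are allowed, i.e. $E(H)$ may contain the same subset several times (each copy is a separate edge with its own weight, and sums over edges count copies separately). Edges need not have the same size. A set of vertices of any cardinality is called a twin set if all vertices in the set are contained in exactly the same set of edges. "An edge consists of a twin set" means that the vertex set of the edge is a twin set. In particular, the empty set and every single vertex are twin sets, so the hypothesis excludes edges of size $0$ and $1$. A function on $V(H)$ properly colors $V(H)$ if no edge is monochromatic, i.e. every edge contains at least two vertices with different values. *)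

theory Defs imports Main begin

(* Multiple edges: an edge is an abstract element of edges H, and ends H e is its vertex set.
   Distinct edges may have the same vertex set. *)
record ('v, 'e) hypergraph =
  verts :: "'v set"
  edges :: "'e set"
  ends :: "'e \<Rightarrow> 'v set"

definition is_hypergraph :: "('v, 'e) hypergraph \<Rightarrow> bool" where
  "is_hypergraph H \<longleftrightarrow> (\<forall>e\<in>edges H. ends H e \<subseteq> verts H)"

definition finite_hypergraph :: "('v, 'e) hypergraph \<Rightarrow> bool" where
  "finite_hypergraph H \<longleftrightarrow> is_hypergraph H \<and> finite (verts H) \<and> finite (edges H)"

definition incident_edges :: "('v, 'e) hypergraph \<Rightarrow> 'v \<Rightarrow> 'e set" where
  "incident_edges H v = {e \<in> edges H. v \<in> ends H e}"

definition twin_set :: "('v, 'e) hypergraph \<Rightarrow> 'v set \<Rightarrow> bool" where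
  "twin_set H X \<longleftrightarrow>
     X \<subseteq> verts H \<and> (\<forall>u\<in>X. \<forall>v\<in>X. incident_edges H u = incident_edges H v)"

definition properly_colors :: "('v, 'e) hypergraph \<Rightarrow> ('v \<Rightarrow> 'c) \<Rightarrow> bool" where
  "properly_colors H c \<longleftrightarrow> (\<forall>e\<in>edges H. \<exists>u\<in>ends H e. \<exists>v\<in>ends H e. c u \<noteq> c v)"

definition vertex_weight :: "('v, 'e) hypergraph \<Rightarrow> ('e \<Rightarrow> nat) \<Rightarrow> 'v \<Rightarrow> nat" where
  "vertex_weight H \<rho> v = (\<Sum>e\<in>incident_edges H v. \<rho> e)"

end

theory Submission imports Defs begin

text \<open>
  Twins always have equal weight, so keep one vertex of each twin class; every edge then has at
  least two vertices. The vertices are processed in an order, as in the algorithm of Kalkowski,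
  Karonski and Pfender: an edge whose first two vertices are \<open>u\<close> and \<open>v\<close> is changed by 2 when \<open>v\<close> is
  reached, which leaves the weight of \<open>u\<close> in a class \<open>{w, w + 2}\<close> with \<open>w mod 4 < 2\<close>, and the class of
  \<open>v\<close> is chosen different from those of all such \<open>u\<close>. This needs every vertex of the order to be the
  first vertex of some edge; only the last one may instead be the second vertex of edges with two
  different first vertices.

  Call a set \<open>Z\<close> of vertices closed if no edge meets it in exactly one vertex. By induction the edges
  meeting \<open>Z\<close> can be made non-monochromatic inside \<open>Z\<close>. Say that two vertices of \<open>Z\<close> are neighbours
  if some edge meets \<open>Z\<close> in exactly these two. A vertex without neighbours can be dropped. A vertex
  with two neighbours serves as the last vertex of an order, obtained by repeatedly prepending a
  vertex that is the only one of its edge still outside the order; the rest of \<open>Z\<close> is again closed.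
  Otherwise the neighbours form a perfect matching \<open>\<pi>\<close>. It is then enough to separate
  all pairs \<open>{x, \<pi> x}\<close>, which a greedy choice does with \<open>r + 1\<close> values, and to treat the edges that
  contain no pair. These are handled by a second induction of the same kind, in which the matching
  edges shift both weights of a pair simultaneously.
\<close>

section \<open>Sequential reweighting along an ordering\<close>

text \<open>The integers split into the pairs \<open>{c, c + 2}\<close> with
  \<open>c mod 4 < 2\<close>; this is the lower end of the pair containing \<open>x\<close>.\<close>

definition low :: "int \<Rightarrow> int" where
  "low x = (if x mod 4 < 2 then x else x - 2)"

lemma low_mod: "low x mod 4 < 2"
  unfolding low_def by presburger

lemma low_mod_2: "low x mod 2 = x mod 2"
  unfolding low_def by presburger

lemma low_add_4: "low (x + 4 * a) = low x + 4 * a"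
  unfolding low_def by simp

text \<open>Neighbouring values \<open>B + 2 * int i\<close> may share a class, so they alone can
  reach too few. The option to subtract 1 supplies the other parity and makes \<open>d + 1\<close>
  classes available, one more than \<open>F\<close> can hold.\<close>

lemma exists_free_class:
  fixes F :: "int set" and B :: int
  assumes "finite F" "card F \<le> d"
  shows "\<exists>i\<le>d. \<exists>c. c mod 4 < 2 \<and> c \<notin> F \<and>
    (B + 2 * int i = c \<or> B + 2 * int i = c + 2 \<or> B + 2 * int i - 1 = c)"
proof -
  \<comment> \<open>Even \<open>i\<close> uses the value itself and odd \<open>i\<close> the value
    minus 1. The two kinds differ in parity, and within one kind the steps are multiples of 4, so
    \<open>h\<close> is injective.\<close>
  define h where "h i = low (B + 2 * int i - int (i mod 2))" for i
  have inj: "inj_on h {..d}"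
  proof (rule inj_onI)
    fix i j assume eq: "h i = h j"
    have h: "h k = low (B + int (k mod 2)) + 4 * int (k div 2)" for k
    proof -
      have "B + 2 * int k - int (k mod 2) = B + int (k mod 2) + 4 * int (k div 2)" by presburger
      then show ?thesis unfolding h_def by (simp only: low_add_4)
    qed
    have "h k mod 2 = (B + int (k mod 2)) mod 2" for k
      unfolding h using low_mod_2[of "B + int (k mod 2)"] by presburger
    then have "(B + int (i mod 2)) mod 2 = (B + int (j mod 2)) mod 2" using eq by metis
    then have m: "i mod 2 = j mod 2" by presburger
    then have "i div 2 = j div 2" using eq unfolding h by simp
    then show "i = j" using m by (metis mult_div_mod_eq)
  qed
  have "card (h ` {..d}) = Suc d" using card_image[OF inj] by simp
  then have "\<not> h ` {..d} \<subseteq> F"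
    using assms card_mono by (metis Suc_n_not_le_n le_trans)
  then obtain i where i: "i \<le> d" "h i \<notin> F" by auto
  have lm: "h i mod 4 < 2" unfolding h_def by (rule low_mod)
  show ?thesis
  proof (cases "h i = B + 2 * int i \<or> h i + 2 = B + 2 * int i \<or> h i = B + 2 * int i - 1")
    case True then show ?thesis using i lm by metis
  next
    case False
    \<comment> \<open>If the odd candidate is the upper end of its class, then the lower end is the
      value for \<open>i - 1\<close> minus 1.\<close>
    then have odd: "i mod 2 = 1" and "h i = B + 2 * int i - 3"
      unfolding h_def low_def by (auto split: if_splits)
    then have "B + 2 * int (i - 1) - 1 = h i" by (cases i) auto
    moreover have "i - 1 \<le> d" using i by simp
    ultimately show ?thesis using i lm by metis
  qed
qed

text \<open>Vertices are the indices below \<open>n\<close>; \<open>f e\<close> and \<open>g e\<close> are the first two vertices of the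
  edge \<open>e\<close>, with \<open>n \<le> g e\<close> if \<open>e\<close> has only one.\<close>

locale ordered_edges =
  fixes E E1 :: "'e set" and M :: "'e \<Rightarrow> nat set" and f g :: "'e \<Rightarrow> nat" and n :: nat
  assumes finE: "finite E" and E1E: "E1 \<subseteq> E"
    and fg: "e \<in> E1 \<Longrightarrow> f e < g e"
    and fM: "e \<in> E1 \<Longrightarrow> f e \<in> M e"
    and gM: "e \<in> E1 \<Longrightarrow> g e < n \<Longrightarrow> g e \<in> M e"
    and Mfg: "e \<in> E1 \<Longrightarrow> i \<in> M e \<Longrightarrow> i < n \<Longrightarrow> i = f e \<or> g e \<le> i"
begin

definition wt :: "('e \<Rightarrow> int) \<Rightarrow> nat \<Rightarrow> int" where
  "wt \<rho> i = (\<Sum>e | e \<in> E \<and> i \<in> M e. \<rho> e)"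

text \<open>Only this edge may be lowered by 1 when \<open>k\<close> is processed. As its second
  vertex is the least possible, the weight of \<open>k\<close> is still unchanged when that vertex
  is reached.\<close>

definition next_edge :: "nat \<Rightarrow> 'e" where
  "next_edge k = (ARG_MIN g e. e \<in> E1 \<and> f e = k)"

lemma next_edge:
  assumes "e \<in> E1"
  shows "next_edge (f e) \<in> E1" "f (next_edge (f e)) = f e" "g (next_edge (f e)) \<le> g e"
  using arg_min_nat_lemma[of "\<lambda>e'. e' \<in> E1 \<and> f e' = f e" e g] assms
  unfolding next_edge_def by auto

definition preds :: "nat \<Rightarrow> nat set" where
  "preds k = f ` {e \<in> E1. g e = k}"

lemma finite_preds: "finite (preds k)"
  unfolding preds_def using finite_subset[OF E1E finE] by simp

lemma wt_shift:
  assumes "A \<subseteq> E"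
  shows "wt (\<lambda>e. \<rho> e + (if e \<in> A then d e else 0)) i = wt \<rho> i + (\<Sum>e | e \<in> A \<and> i \<in> M e. d e)"
proof -
  have "{e \<in> {e \<in> E. i \<in> M e}. e \<in> A} = {e \<in> A. i \<in> M e}" using assms by auto
  then show ?thesis unfolding wt_def using finE
    by (simp add: sum.distrib sum.If_cases Int_def)
qed

text \<open>The vertices below \<open>k\<close> have been processed: from now on the weight of \<open>i\<close> stays in
  \<open>{L i, L i + 2}\<close>. An edge whose first vertex is processed and whose second is not has weight 3,
  or possibly 2 if it can still be raised when the second vertex is processed.\<close>

definition stage :: "('e \<Rightarrow> int) \<Rightarrow> nat \<Rightarrow> ('e \<Rightarrow> int) \<Rightarrow> (nat \<Rightarrow> int) \<Rightarrow> bool" where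
  "stage \<rho>\<^sub>0 k \<rho> L \<longleftrightarrow>
     (\<forall>e. e \<notin> E1 \<longrightarrow> \<rho> e = \<rho>\<^sub>0 e) \<and> (\<forall>e\<in>E1. \<rho> e \<in> {1..5}) \<and>
     (\<forall>e\<in>E1. k \<le> f e \<longrightarrow> \<rho> e = 3) \<and>
     (\<forall>e\<in>E1. f e < k \<longrightarrow> k \<le> g e \<longrightarrow>
        \<rho> e = 3 \<or> e = next_edge (f e) \<and> \<rho> e = 2 \<and> wt \<rho> (f e) = L (f e)) \<and>
     (\<forall>i<k. L i mod 4 < 2 \<and> (wt \<rho> i = L i \<or> wt \<rho> i = L i + 2)) \<and>
     (\<forall>e\<in>E1. g e < k \<longrightarrow> L (f e) \<noteq> L (g e))"

text \<open>For each predecessor one edge ending at \<open>k\<close> is changed by -2, 0 or 2, which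
  moves the predecessor to the chosen end of its class. \<open>B\<close> is the weight of
  \<open>k\<close> with all predecessors at the lower end, so only the size of \<open>T\<close>
  enters the new weight of \<open>k\<close>.\<close>

lemma toggle:
  assumes st: "stage \<rho>\<^sub>0 k \<rho> L" and kn: "k < n" and T: "T \<subseteq> preds k"
  defines "B \<equiv> wt \<rho> k - (\<Sum>p\<in>preds k. wt \<rho> p - L p)"
  obtains \<rho>' where "\<And>e. e \<notin> E1 \<Longrightarrow> \<rho>' e = \<rho>\<^sub>0 e" "\<And>e. e \<in> E1 \<Longrightarrow> \<rho>' e \<in> {1..5}"
    "\<And>e. e \<in> E1 \<Longrightarrow> k \<le> f e \<Longrightarrow> \<rho>' e = 3"
    "\<And>e. e \<in> E1 \<Longrightarrow> f e < k \<Longrightarrow> k < g e \<Longrightarrow>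
        \<rho>' e = 3 \<or> e = next_edge (f e) \<and> \<rho>' e = 2 \<and> wt \<rho>' (f e) = L (f e)"
    "\<And>p. p \<in> preds k \<Longrightarrow> wt \<rho>' p = L p + (if p \<in> T then 2 else 0)"
    "\<And>i. i < k \<Longrightarrow> i \<notin> preds k \<Longrightarrow> wt \<rho>' i = wt \<rho> i"
    "wt \<rho>' k = B + 2 * int (card T)"
proof -
  let ?P = "preds k"
  have "\<forall>p\<in>?P. \<exists>e. e \<in> E1 \<and> f e = p \<and> g e = k" unfolding preds_def by auto
  then obtain q where q: "p \<in> ?P \<Longrightarrow> q p \<in> E1" "p \<in> ?P \<Longrightarrow> f (q p) = p" "p \<in> ?P \<Longrightarrow> g (q p) = k" for p
    by metis
  define d where "d p = (if p \<in> T then 2 else 0) - (wt \<rho> p - L p)" for p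
  define \<rho>' where "\<rho>' e = \<rho> e + (if e \<in> q ` ?P then d (f e) else 0)" for e
  have Plt: "p < k" if "p \<in> ?P" for p using that fg unfolding preds_def by auto
  have injq: "inj_on q ?P" using q(2) by (metis inj_on_inverseI)
  have sub: "q ` ?P \<subseteq> E" using q(1) E1E by auto
  have wt': "wt \<rho>' i = wt \<rho> i + (\<Sum>p | p \<in> ?P \<and> i \<in> M (q p). d p)" for i
  proof -
    have "wt \<rho>' i = wt \<rho> i + (\<Sum>e | e \<in> q ` ?P \<and> i \<in> M e. d (f e))"
      unfolding \<rho>'_def by (rule wt_shift[OF sub])
    also have "{e. e \<in> q ` ?P \<and> i \<in> M e} = q ` {p \<in> ?P. i \<in> M (q p)}" by auto
    also have "(\<Sum>e\<in>q ` {p \<in> ?P. i \<in> M (q p)}. d (f e)) = (\<Sum>p | p \<in> ?P \<and> i \<in> M (q p). d p)"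
      using inj_on_subset[OF injq, of "{p \<in> ?P. i \<in> M (q p)}"] q(2) by (subst sum.reindex) auto
    finally show ?thesis .
  qed
  have below: "i = p" if "p \<in> ?P" "i \<in> M (q p)" "i < k" for i p
    using Mfg[OF q(1)[OF that(1)] that(2)] that(3) kn q(2,3)[OF that(1)] by auto
  have wtp: "wt \<rho>' p = L p + (if p \<in> T then 2 else 0)" if p: "p \<in> ?P" for p
  proof -
    have "{p' \<in> ?P. p \<in> M (q p')} = {p}"
      using below Plt[OF p] p fM[OF q(1)[OF p]] q(2)[OF p] by auto
    then show ?thesis unfolding wt' by (simp add: d_def)
  qed
  have wto: "wt \<rho>' i = wt \<rho> i" if "i < k" "i \<notin> ?P" for i
  proof -
    have "{p' \<in> ?P. i \<in> M (q p')} = {}" using below that by auto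
    then show ?thesis unfolding wt' by (simp only:) simp
  qed
  have "{p \<in> ?P. k \<in> M (q p)} = ?P" using gM[OF q(1)] q(3) kn by auto
  then have "wt \<rho>' k = wt \<rho> k + (\<Sum>p\<in>?P. d p)" unfolding wt' by simp
  also have "(\<Sum>p\<in>?P. d p) = 2 * int (card T) - (\<Sum>p\<in>?P. wt \<rho> p - L p)"
    unfolding d_def using T finite_preds[of k]
    by (simp add: sum_subtractf sum.If_cases Int_absorb1)
  finally have wtk: "wt \<rho>' k = B + 2 * int (card T)" unfolding B_def by simp
  have st1: "\<And>e. e \<notin> E1 \<Longrightarrow> \<rho> e = \<rho>\<^sub>0 e" "\<And>e. e \<in> E1 \<Longrightarrow> \<rho> e \<in> {1..5}"
    "\<And>e. e \<in> E1 \<Longrightarrow> k \<le> f e \<Longrightarrow> \<rho> e = 3"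
    and st4: "\<And>e. e \<in> E1 \<Longrightarrow> f e < k \<Longrightarrow> k \<le> g e \<Longrightarrow>
        \<rho> e = 3 \<or> e = next_edge (f e) \<and> \<rho> e = 2 \<and> wt \<rho> (f e) = L (f e)"
    and st5: "\<And>i. i < k \<Longrightarrow> wt \<rho> i = L i \<or> wt \<rho> i = L i + 2"
    using st unfolding stage_def by blast+
  show thesis
  proof (rule that[of \<rho>'])
    show "\<rho>' e = \<rho>\<^sub>0 e" if "e \<notin> E1" for e
      using that q(1) st1(1) unfolding \<rho>'_def by auto
    show "\<rho>' e \<in> {1..5}" if e: "e \<in> E1" for e
    proof (cases "e \<in> q ` ?P")
      case True
      then obtain p where p: "p \<in> ?P" "e = q p" by auto
      \<comment> \<open>From 3 the new value is 1, 3 or 5. From 2 a decrease cannot occur, because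
        the predecessor is at its lower end, so the new value is 2 or 4.\<close>
      have "\<rho> e = 3 \<or> \<rho> e = 2 \<and> wt \<rho> p = L p"
        using st4[OF q(1)[OF p(1)]] q(2,3)[OF p(1)] Plt[OF p(1)] p(2) by auto
      moreover have "wt \<rho> p = L p \<or> wt \<rho> p = L p + 2" using st5 Plt p(1) by auto
      moreover have "\<rho>' e = \<rho> e + d p" using True p q(2) unfolding \<rho>'_def by simp
      ultimately show ?thesis unfolding d_def by auto
    qed (use st1(2) e in \<open>simp add: \<rho>'_def\<close>)
    show "\<rho>' e = 3" if "e \<in> E1" "k \<le> f e" for e
    proof -
      have "e \<notin> q ` ?P" using that(2) q(2) Plt by fastforce
      then show ?thesis using st1(3) that unfolding \<rho>'_def by simp
    qed
    show "\<rho>' e = 3 \<or> e = next_edge (f e) \<and> \<rho>' e = 2 \<and> wt \<rho>' (f e) = L (f e)"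
      if e: "e \<in> E1" "f e < k" "k < g e" for e
    proof -
      have "e \<notin> q ` ?P" using e(3) q(3) by fastforce
      then have same: "\<rho>' e = \<rho> e" unfolding \<rho>'_def by simp
      show ?thesis
      proof (cases "e = next_edge (f e)")
        case True
        \<comment> \<open>Among the edges starting at \<open>f e\<close>, \<open>e\<close> has the
          least second vertex, and this is beyond \<open>k\<close>. So none of them ends at
          \<open>k\<close>, and \<open>f e\<close> stays at its lower end.\<close>
        have "f e \<notin> ?P"
        proof
          assume "f e \<in> ?P"
          then show False using next_edge(3)[of "q (f e)"] q True e(3) by (metis not_less)
        qed
        then show ?thesis using st4[of e] e same wto[OF e(2)] by auto
      qed (use st4[of e] e same in auto)
    qed
  qed (use wtp wto wtk in auto)
qed

lemma low_disjoint:
  fixes a b x y :: int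
  assumes "a mod 4 < 2" "b mod 4 < 2" "a \<noteq> b" "x = a \<or> x = a + 2" "y = b \<or> y = b + 2"
  shows "x \<noteq> y"
  using assms by presburger

lemma stage_0: "\<exists>\<rho>. stage \<rho>\<^sub>0 0 \<rho> L"
  by (rule exI[of _ "\<lambda>e. if e \<in> E1 then 3 else \<rho>\<^sub>0 e"]) (simp add: stage_def)

text \<open>Some class avoids those of all predecessors. It is reached by raising \<open>i\<close>
  of them and, if needed, lowering \<open>next_edge k\<close> by 1; \<open>e0\<close> ensures that
  this edge exists.\<close>

lemma stage_Suc:
  assumes st: "stage \<rho>\<^sub>0 k \<rho> L" and kn: "k < n" and e0: "e0 \<in> E1" "f e0 = k"
  shows "\<exists>\<rho>' L'. stage \<rho>\<^sub>0 (Suc k) \<rho>' L'"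
proof -
  define B where "B = wt \<rho> k - (\<Sum>p\<in>preds k. wt \<rho> p - L p)"
  have "card (L ` preds k) \<le> card (preds k)" by (rule card_image_le[OF finite_preds])
  then obtain i c where i: "i \<le> card (preds k)" and c: "c mod 4 < 2" "c \<notin> L ` preds k"
    and ic: "B + 2 * int i = c \<or> B + 2 * int i = c + 2 \<or> B + 2 * int i - 1 = c"
    using exists_free_class[of "L ` preds k" "card (preds k)" B] finite_preds by blast
  obtain T where T: "T \<subseteq> preds k" "card T = i" using obtain_subset_with_card_n[OF i] by blast
  obtain \<rho>' where a1: "\<And>e. e \<notin> E1 \<Longrightarrow> \<rho>' e = \<rho>\<^sub>0 e" and a2: "\<And>e. e \<in> E1 \<Longrightarrow> \<rho>' e \<in> {1..5}"
    and a3: "\<And>e. e \<in> E1 \<Longrightarrow> k \<le> f e \<Longrightarrow> \<rho>' e = 3"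
    and a4: "\<And>e. e \<in> E1 \<Longrightarrow> f e < k \<Longrightarrow> k < g e \<Longrightarrow>
        \<rho>' e = 3 \<or> e = next_edge (f e) \<and> \<rho>' e = 2 \<and> wt \<rho>' (f e) = L (f e)"
    and a5: "\<And>p. p \<in> preds k \<Longrightarrow> wt \<rho>' p = L p + (if p \<in> T then 2 else 0)"
    and a6: "\<And>i. i < k \<Longrightarrow> i \<notin> preds k \<Longrightarrow> wt \<rho>' i = wt \<rho> i"
    and a7: "wt \<rho>' k = B + 2 * int i"
    by (rule toggle[OF st kn T(1), folded B_def, unfolded T(2)]) (rule that)
  define L' where "L' = L(k := c)"
  define s where "s = next_edge k"
  have s: "s \<in> E1" "f s = k" using next_edge[OF e0(1)] e0(2) unfolding s_def by auto
  have lows: "L j mod 4 < 2" if "j < k" for j using st that unfolding stage_def by blast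
  have wts: "wt \<rho>' j = L j \<or> wt \<rho>' j = L j + 2" if "j < k" for j
  proof (cases "j \<in> preds k")
    case True then show ?thesis using a5 by auto
  next
    case False then show ?thesis using a6[OF that] st that unfolding stage_def by auto
  qed
  have cls: "L' (f e) \<noteq> L' (g e)" if "e \<in> E1" "g e < Suc k" for e
  proof (cases "g e = k")
    case True
    then have "f e \<in> preds k" using that unfolding preds_def by auto
    then show ?thesis using True fg[OF that(1)] c(2) unfolding L'_def by auto
  next
    case False
    then have "g e < k" using that by simp
    then show ?thesis using that(1) st fg[OF that(1)] unfolding stage_def L'_def by auto
  qed
  have L'lt: "L' j = L j" if "j < k" for j using that unfolding L'_def by simp
  have L'k: "L' k = c" unfolding L'_def by simp
  show ?thesis
  proof (cases "wt \<rho>' k = c \<or> wt \<rho>' k = c + 2")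
    case True
    have "stage \<rho>\<^sub>0 (Suc k) \<rho>' L'"
      unfolding stage_def
    proof (intro conjI ballI allI impI)
      fix e assume e: "e \<in> E1" "f e < Suc k" "Suc k \<le> g e"
      show "\<rho>' e = 3 \<or> e = next_edge (f e) \<and> \<rho>' e = 2 \<and> wt \<rho>' (f e) = L' (f e)"
        using a3[OF e(1)] a4[OF e(1)] e L'lt[of "f e"] by (cases "f e = k") auto
    next
      fix j assume "j < Suc k"
      then show "L' j mod 4 < 2" "wt \<rho>' j = L' j \<or> wt \<rho>' j = L' j + 2"
        using lows[of j] wts[of j] True c(1) L'lt[of j] L'k by (auto simp: less_Suc_eq)
    qed (use a1 a2 a3 cls in auto)
    then show ?thesis by blast
  next
    case False
    \<comment> \<open>In the remaining option, lowering \<open>s\<close> by 1 puts \<open>k\<close>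
      exactly at the lower end, as \<open>stage\<close> requires for an edge of weight 2.\<close>
    then have wk: "wt \<rho>' k - 1 = c" using ic a7 by auto
    define \<rho>'' where "\<rho>'' e = \<rho>' e + (if e \<in> {s} then -1 else 0)" for e
    have w'': "wt \<rho>'' j = wt \<rho>' j + (if j \<in> M s then -1 else 0)" for j
    proof -
      have "wt \<rho>'' j = wt \<rho>' j + (\<Sum>e | e \<in> {s} \<and> j \<in> M e. -1)"
        unfolding \<rho>''_def by (rule wt_shift) (use s E1E in auto)
      moreover have "{e. e \<in> {s} \<and> j \<in> M e} = (if j \<in> M s then {s} else {})" by auto
      ultimately show ?thesis by auto
    qed
    have w''k: "wt \<rho>'' k = c" using w'' fM[OF s(1)] s(2) wk by simp
    have w''lt: "wt \<rho>'' j = wt \<rho>' j" if "j < k" for j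
    proof -
      have "j \<notin> M s" using Mfg[OF s(1), of j] that kn s fg[OF s(1)] by auto
      then show ?thesis using w'' by simp
    qed
    have s3: "\<rho>' s = 3" using a3 s by simp
    have "stage \<rho>\<^sub>0 (Suc k) \<rho>'' L'"
      unfolding stage_def
    proof (intro conjI ballI allI impI)
      fix e assume "e \<notin> E1" then show "\<rho>'' e = \<rho>\<^sub>0 e" using a1 s unfolding \<rho>''_def by auto
    next
      fix e assume e: "e \<in> E1" then show "\<rho>'' e \<in> {1..5}"
        using a2[OF e] s3 unfolding \<rho>''_def by auto
    next
      fix e assume e: "e \<in> E1" "Suc k \<le> f e"
      then show "\<rho>'' e = 3" using a3[OF e(1)] s unfolding \<rho>''_def by auto
    next
      fix e assume e: "e \<in> E1" "f e < Suc k" "Suc k \<le> g e"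
      show "\<rho>'' e = 3 \<or> e = next_edge (f e) \<and> \<rho>'' e = 2 \<and> wt \<rho>'' (f e) = L' (f e)"
      proof (cases "e = s")
        case True
        then show ?thesis using s s3 w''k L'k unfolding s_def \<rho>''_def by auto
      next
        case ne: False
        then have r: "\<rho>'' e = \<rho>' e" unfolding \<rho>''_def by simp
        show ?thesis
        proof (cases "f e = k")
          case True then show ?thesis using a3[OF e(1)] r by simp
        next
          case False
          then have "f e < k" using e by simp
          then show ?thesis using a4[OF e(1)] e r L'lt w''lt by auto
        qed
      qed
    next
      fix j assume "j < Suc k"
      then show "L' j mod 4 < 2" "wt \<rho>'' j = L' j \<or> wt \<rho>'' j = L' j + 2"
        using lows[of j] wts[of j] c(1) L'lt[of j] L'k w''k w''lt[of j] by (auto simp: less_Suc_eq)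
    qed (use cls in auto)
    then show ?thesis by blast
  qed
qed

lemma stage_upto:
  assumes "k \<le> n" "\<And>j. j < k \<Longrightarrow> \<exists>e\<in>E1. f e = j"
  shows "\<exists>\<rho> L. stage \<rho>\<^sub>0 k \<rho> L"
  using assms
proof (induction k)
  case 0 then show ?case using stage_0 by blast
next
  case (Suc k)
  then obtain \<rho> L where "stage \<rho>\<^sub>0 k \<rho> L" by (metis Suc_leD less_Suc_eq)
  moreover obtain e where "e \<in> E1" "f e = k" using Suc.prems by blast
  ultimately show ?case using stage_Suc Suc.prems(1) by (metis Suc_le_eq)
qed

text \<open>If every vertex starts an edge, all are processed and different classes give different
  weights. Otherwise the last vertex has no edge left to lower, but it needs only a weight different
  from those of its predecessors, not a class of its own; two predecessors give enough
  freedom.\<close>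

lemma exists_separating_weights:
  assumes fwd: "\<And>k. k < n \<Longrightarrow> (\<exists>e\<in>E1. f e = k) \<or>
    Suc k = n \<and> (\<exists>e\<in>E1. \<exists>e'\<in>E1. g e = k \<and> g e' = k \<and> f e \<noteq> f e')"
  shows "\<exists>\<rho>. (\<forall>e. e \<notin> E1 \<longrightarrow> \<rho> e = \<rho>\<^sub>0 e) \<and> (\<forall>e\<in>E1. \<rho> e \<in> {1..5}) \<and>
    (\<forall>e\<in>E1. g e < n \<longrightarrow> wt \<rho> (f e) \<noteq> wt \<rho> (g e))"
proof (cases "\<forall>k<n. \<exists>e\<in>E1. f e = k")
  case True
  then obtain \<rho> L where st: "stage \<rho>\<^sub>0 n \<rho> L" using stage_upto by blast
  have "wt \<rho> (f e) \<noteq> wt \<rho> (g e)" if e: "e \<in> E1" "g e < n" for e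
  proof (rule low_disjoint)
    show "L (f e) \<noteq> L (g e)" using st e unfolding stage_def by blast
  qed (use st e fg[OF e(1)] in \<open>auto simp: stage_def\<close>)
  then show ?thesis using st unfolding stage_def by blast
next
  case False
  then obtain k e1 e2 where k: "Suc k = n" and e12: "e1 \<in> E1" "e2 \<in> E1" "g e1 = k" "g e2 = k" "f e1 \<noteq> f e2"
    using fwd by blast
  have "\<exists>e\<in>E1. f e = j" if "j < k" for j using fwd[of j] that k by auto
  then obtain \<rho> L where st: "stage \<rho>\<^sub>0 k \<rho> L" using stage_upto[of k \<rho>\<^sub>0] k by (metis le_less_Suc_eq nat_less_le order_refl le_SucI)
  have kn: "k < n" using k by simp
  define B where "B = wt \<rho> k - (\<Sum>p\<in>preds k. wt \<rho> p - L p)"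
  define a b where "a = f e1" and "b = f e2"
  have ab: "a \<in> preds k" "b \<in> preds k" "a \<noteq> b" using e12 unfolding preds_def a_def b_def by auto
  have lows: "L j mod 4 < 2" if "j < k" for j using st that unfolding stage_def by blast
  have Plt: "p < k" if "p \<in> preds k" for p using that fg unfolding preds_def by auto
  \<comment> \<open>If \<open>B\<close> is no lower end of a predecessor, raise nobody. If it is,
    then none of them has lower end \<open>B + 2\<close>: raise one predecessor with lower end other
    than \<open>B\<close> or, if all equal \<open>B\<close>, two of them, so that \<open>k\<close>
    gets \<open>B + 4\<close>.\<close>
  have "\<exists>T\<subseteq>preds k. \<forall>p\<in>preds k. L p + (if p \<in> T then 2 else 0) \<noteq> B + 2 * int (card T)"
  proof (cases "\<exists>p\<in>preds k. L p = B")
    case False then show ?thesis by (intro exI[of _ "{}"]) auto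
  next
    case True
    then have "B mod 4 < 2" using lows Plt by auto
    have nB: "L p \<noteq> B + 2" if "p \<in> preds k" for p
    proof
      assume "L p = B + 2"
      then show False using lows[OF Plt[OF that]] \<open>B mod 4 < 2\<close> by presburger
    qed
    show ?thesis
    proof (cases "\<exists>j\<in>preds k. L j \<noteq> B")
      case True
      then obtain j where "j \<in> preds k" "L j \<noteq> B" by blast
      then show ?thesis using nB by (intro exI[of _ "{j}"]) auto
    next
      case False
      then show ?thesis using ab by (intro exI[of _ "{a, b}"]) auto
    qed
  qed
  then obtain T where T: "T \<subseteq> preds k"
    "\<And>p. p \<in> preds k \<Longrightarrow> L p + (if p \<in> T then 2 else 0) \<noteq> B + 2 * int (card T)" by blast
  obtain \<rho>' where a1: "\<And>e. e \<notin> E1 \<Longrightarrow> \<rho>' e = \<rho>\<^sub>0 e" and a2: "\<And>e. e \<in> E1 \<Longrightarrow> \<rho>' e \<in> {1..5}"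
    and a5: "\<And>p. p \<in> preds k \<Longrightarrow> wt \<rho>' p = L p + (if p \<in> T then 2 else 0)"
    and a6: "\<And>i. i < k \<Longrightarrow> i \<notin> preds k \<Longrightarrow> wt \<rho>' i = wt \<rho> i"
    and a7: "wt \<rho>' k = B + 2 * int (card T)"
    by (rule toggle[OF st kn T(1), folded B_def]) (rule that)
  have wts: "wt \<rho>' j = L j \<or> wt \<rho>' j = L j + 2" if "j < k" for j
  proof (cases "j \<in> preds k")
    case True then show ?thesis using a5 by auto
  next
    case False then show ?thesis using a6[OF that] st that unfolding stage_def by auto
  qed
  have "wt \<rho>' (f e) \<noteq> wt \<rho>' (g e)" if e: "e \<in> E1" "g e < n" for e
  proof (cases "g e = k")
    case True
    then have "f e \<in> preds k" using e unfolding preds_def by auto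
    then show ?thesis using a5 a7 T(2) True by auto
  next
    case False
    then have gk: "g e < k" using e k by simp
    show ?thesis
    proof (rule low_disjoint)
      show "L (f e) \<noteq> L (g e)" using st e gk unfolding stage_def by blast
    qed (use lows wts fg[OF e(1)] gk in auto)
  qed
  then show ?thesis using a1 a2 by blast
qed

end

section \<open>Separating three pairs of integers\<close>

text \<open>Only the differences of the shifts matter, which \<open>sep\<close> expresses. For
  sorted pairs a fixed list of fifteen shift triples suffices; linear arithmetic checks that one of
  them always works.\<close>

lemma separate_three_sorted_pairs:
  fixes a b c a' b' c' :: int
  assumes "a < a'" "b < b'" "c < c'" "a \<le> b" "b \<le> c"
  shows "\<exists>x\<in>{1..5}. \<exists>y\<in>{1..5}. \<exists>z\<in>{1..5}. {a + x, a' + x} \<inter> {b + y, b' + y} = {} \<and>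
    {a + x, a' + x} \<inter> {c + z, c' + z} = {} \<and> {b + y, b' + y} \<inter> {c + z, c' + z} = {}"
proof -
  define sep :: "int \<Rightarrow> int \<Rightarrow> int \<Rightarrow> int \<Rightarrow> int \<Rightarrow> bool"
    where "sep t u u' v v' \<longleftrightarrow> u \<noteq> v + t \<and> u \<noteq> v' + t \<and> u' \<noteq> v + t \<and> u' \<noteq> v' + t" for t u u' v v'
  have disj: "{u + x, u' + x} \<inter> {v + y, v' + y} = {}" if "sep (y - x) u u' v v'" for x y u u' v v'
  proof -
    have "u + x \<noteq> v + y" "u + x \<noteq> v' + y" "u' + x \<noteq> v + y" "u' + x \<noteq> v' + y"
      using that unfolding sep_def by linarith+
    then show ?thesis by simp
  qed
  define S :: "(int \<times> int \<times> int) set" where "S = {(1,2,3),(1,3,5),(4,1,5),(5,1,4),(1,5,4),(2,1,5),(1,5,1),(3,1,5),(1,4,5),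
      (4,1,4),(1,2,5),(3,5,1),(3,1,4),(1,1,4),(5,1,3)}"
  have "\<exists>(x, y, z)\<in>S. sep (y - x) a a' b b' \<and> sep (z - x) a a' c c' \<and> sep (z - y) b b' c c'"
    using assms unfolding sep_def S_def by simp (smt (z3))
  then obtain x y z where S: "(x, y, z) \<in> S"
    and "sep (y - x) a a' b b'" "sep (z - x) a a' c c'" "sep (z - y) b b' c c'"
    by blast
  moreover have "S \<subseteq> {1..5} \<times> {1..5} \<times> {1..5}" unfolding S_def by simp
  then have "x \<in> {1..5}" "y \<in> {1..5}" "z \<in> {1..5}" using S by blast+
  ultimately show ?thesis using disj by blast
qed

text \<open>Swapping within a pair and permuting the pairs reduce this to the sorted case.\<close>

lemma separate_three_pairs:
  fixes a b c a' b' c' :: int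
  assumes "a \<noteq> a'" "b \<noteq> b'" "c \<noteq> c'"
  obtains x y z where "x \<in> {1..5}" "y \<in> {1..5}" "z \<in> {1..5}"
    "{a + x, a' + x} \<inter> {b + y, b' + y} = {}" "{a + x, a' + x} \<inter> {c + z, c' + z} = {}"
    "{b + y, b' + y} \<inter> {c + z, c' + z} = {}"
proof -
  define sh :: "int set \<Rightarrow> int \<Rightarrow> int set" where "sh A x = (\<lambda>i. i + x) ` A" for A x
  define Q where "Q A B C \<longleftrightarrow> (\<exists>x\<in>{1..5}. \<exists>y\<in>{1..5}. \<exists>z\<in>{1..5}.
    sh A x \<inter> sh B y = {} \<and> sh A x \<inter> sh C z = {} \<and> sh B y \<inter> sh C z = {})" for A B C
  have sw1: "Q A B C \<Longrightarrow> Q B A C" for A B C unfolding Q_def by (metis Int_commute)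
  have sw2: "Q A B C \<Longrightarrow> Q A C B" for A B C unfolding Q_def by (metis Int_commute)
  have sorted: "Q {u, u'} {v, v'} {w, w'}"
    if "u < u'" "v < v'" "w < w'" "u \<le> v" "v \<le> w" for u u' v v' w w'
    using separate_three_sorted_pairs[OF that] unfolding Q_def sh_def by simp
  have lt: "Q {u, u'} {v, v'} {w, w'}" if "u < u'" "v < v'" "w < w'" for u u' v v' w w'
  proof -
    consider "u \<le> v" "v \<le> w" | "u \<le> w" "w \<le> v" | "v \<le> u" "u \<le> w" | "v \<le> w" "w \<le> u"
      | "w \<le> u" "u \<le> v" | "w \<le> v" "v \<le> u" by linarith
    then show ?thesis using that sorted sw1 sw2 by cases metis+
  qed
  have "{u, u'} = {min u u', max u u'}" for u u' :: int by (auto simp: min_def max_def)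
  moreover have "Q {min a a', max a a'} {min b b', max b b'} {min c c', max c c'}"
    by (rule lt) (use assms in auto)
  ultimately have "Q {a, a'} {b, b'} {c, c'}" by metis
  then obtain x y z where xyz: "x \<in> {1..5}" "y \<in> {1..5}" "z \<in> {1..5}"
    and dis: "sh {a, a'} x \<inter> sh {b, b'} y = {}" "sh {a, a'} x \<inter> sh {c, c'} z = {}"
      "sh {b, b'} y \<inter> sh {c, c'} z = {}" unfolding Q_def by blast
  show thesis by (rule that[OF xyz]) (use dis in \<open>simp_all add: sh_def\<close>)
qed

section \<open>Weighted sums avoiding zero\<close>

text \<open>Each \<open>x\<close> rules out at most one \<open>t\<close>, namely
  \<open>- b x div a x\<close>.\<close>

lemma exists_avoiding_value:
  fixes a b :: "'a \<Rightarrow> int"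
  assumes "finite P" "card P < m" "\<And>x. x \<in> P \<Longrightarrow> a x \<noteq> 0"
  shows "\<exists>t\<in>{1..int m}. \<forall>x\<in>P. b x + a x * t \<noteq> 0"
proof -
  have "card ((\<lambda>x. - b x div a x) ` P) < m" using card_image_le[OF assms(1)] assms(2) by (rule le_less_trans)
  then have "\<not> {1..int m} \<subseteq> (\<lambda>x. - b x div a x) ` P"
    using card_mono[OF finite_imageI[OF assms(1)], of "{1..int m}" "\<lambda>x. - b x div a x"] by auto
  then obtain t where t: "t \<in> {1..int m}" "t \<notin> (\<lambda>x. - b x div a x) ` P" by blast
  have "b x + a x * t \<noteq> 0" if x: "x \<in> P" for x
  proof
    assume "b x + a x * t = 0"
    then have "- b x = a x * t" by linarith
    then have "- b x div a x = t" using assms(3)[OF x] by simp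
    then show False using t(2) x by blast
  qed
  then show ?thesis using t(1) by blast
qed

text \<open>The edges receive values one after another, each avoiding a zero partial sum for every
  \<open>x\<close> that it affects. The last edge affecting \<open>x\<close> thus leaves a nonzero
  total. Values already fixed are absorbed into \<open>b\<close>.\<close>

lemma exists_weighting_avoiding_zero:
  fixes a :: "'a \<Rightarrow> 'e \<Rightarrow> int"
  assumes "finite F" "finite P" "\<And>e. e \<in> F \<Longrightarrow> card {x \<in> P. a x e \<noteq> 0} < m" "0 < m"
  shows "\<exists>\<rho>. (\<forall>e. \<rho> e \<in> {1..int m}) \<and>
    (\<forall>x\<in>P. (\<exists>e\<in>F. a x e \<noteq> 0) \<longrightarrow> b x + (\<Sum>e\<in>F. a x e * \<rho> e) \<noteq> 0)"
  using assms(1,3)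
proof (induction F arbitrary: b rule: finite_induct)
  case empty
  show ?case using assms(4) by (intro exI[of _ "\<lambda>_. 1"]) auto
next
  case (insert e F)
  have "\<exists>t\<in>{1..int m}. \<forall>x\<in>{x \<in> P. a x e \<noteq> 0}. b x + a x e * t \<noteq> 0"
    by (rule exists_avoiding_value) (use assms(2) insert.prems in auto)
  then obtain t where t: "t \<in> {1..int m}" "\<And>x. x \<in> P \<Longrightarrow> a x e \<noteq> 0 \<Longrightarrow> b x + a x e * t \<noteq> 0"
    by blast
  obtain \<rho> where \<rho>: "\<And>e. \<rho> e \<in> {1..int m}"
    "\<And>x. x \<in> P \<Longrightarrow> \<exists>e\<in>F. a x e \<noteq> 0 \<Longrightarrow> b x + a x e * t + (\<Sum>e\<in>F. a x e * \<rho> e) \<noteq> 0"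
    using insert.IH[of "\<lambda>x. b x + a x e * t"] insert.prems by blast
  have sum: "(\<Sum>e'\<in>insert e F. a x e' * (\<rho>(e := t)) e') = a x e * t + (\<Sum>e\<in>F. a x e * \<rho> e)" for x
  proof -
    have "(\<Sum>e'\<in>F. a x e' * (\<rho>(e := t)) e') = (\<Sum>e\<in>F. a x e * \<rho> e)"
      by (rule sum.cong) (use insert.hyps in auto)
    then show ?thesis using insert.hyps by simp
  qed
  have "b x + (\<Sum>e'\<in>insert e F. a x e' * (\<rho>(e := t)) e') \<noteq> 0"
    if x: "x \<in> P" "\<exists>e'\<in>insert e F. a x e' \<noteq> 0" for x
  proof (cases "\<exists>e\<in>F. a x e \<noteq> 0")
    case True
    then show ?thesis unfolding sum using \<rho>(2)[OF x(1)] by (simp add: add.assoc)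
  next
    case False
    then have "(\<Sum>e\<in>F. a x e * \<rho> e) = 0" by (simp add: sum.neutral)
    then show ?thesis unfolding sum using t(2)[OF x(1)] False x(2) by auto
  qed
  then show ?case using \<rho>(1) t(1) by (intro exI[of _ "\<rho>(e := t)"]) auto
qed

section \<open>Hypergraphs without twins\<close>

text \<open>\<open>R\<close> will hold one vertex of each twin class, \<open>N e\<close> the
  representatives in \<open>e\<close>, and \<open>m\<close> will be
  \<open>max 5 (r + 1)\<close>.\<close>

locale twin_free =
  fixes R :: "'v set" and E :: "'e set" and N :: "'e \<Rightarrow> 'v set" and m :: nat
  assumes finR: "finite R" and finE: "finite E" and NR: "e \<in> E \<Longrightarrow> N e \<subseteq> R"
    and cardN: "e \<in> E \<Longrightarrow> card (N e) < m" and m5: "5 \<le> m"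
    and separated: "u \<in> R \<Longrightarrow> v \<in> R \<Longrightarrow> u \<noteq> v \<Longrightarrow> \<exists>e\<in>E. (u \<in> N e) \<noteq> (v \<in> N e)"
begin

definition W :: "('e \<Rightarrow> int) \<Rightarrow> 'v \<Rightarrow> int" where
  "W \<rho> v = (\<Sum>e | e \<in> E \<and> v \<in> N e. \<rho> e)"

definition proper :: "('e \<Rightarrow> int) \<Rightarrow> 'v set \<Rightarrow> 'e \<Rightarrow> bool" where
  "proper \<rho> S e \<longleftrightarrow> (\<exists>u\<in>N e \<inter> S. \<exists>v\<in>N e \<inter> S. W \<rho> u \<noteq> W \<rho> v)"

definition closed :: "'e set \<Rightarrow> 'v set \<Rightarrow> bool" where
  "closed F Z \<longleftrightarrow> (\<forall>e\<in>F. card (N e \<inter> Z) \<noteq> 1)"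

lemma W_cong: "(\<And>e. e \<in> E \<Longrightarrow> v \<in> N e \<Longrightarrow> \<rho> e = \<rho>' e) \<Longrightarrow> W \<rho> v = W \<rho>' v"
  unfolding W_def by (rule sum.cong) auto

lemma W_upd:
  assumes "e \<in> E"
  shows "W (\<rho>(e := t)) v = W \<rho> v + (if v \<in> N e then t - \<rho> e else 0)"
proof (cases "v \<in> N e")
  case True
  let ?S = "{e \<in> E. v \<in> N e}"
  have S: "finite ?S" "e \<in> ?S" using finE True assms by auto
  have "sum (\<rho>(e := t)) (?S - {e}) = sum \<rho> (?S - {e})" by (rule sum.cong) auto
  moreover have "sum (\<rho>(e := t)) ?S = (\<rho>(e := t)) e + sum (\<rho>(e := t)) (?S - {e})"
    by (rule sum.remove[OF S])
  moreover have "sum \<rho> ?S = \<rho> e + sum \<rho> (?S - {e})" by (rule sum.remove[OF S])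
  ultimately have "sum (\<rho>(e := t)) ?S = sum \<rho> ?S + (t - \<rho> e)" by (simp only: fun_upd_same)
  then show ?thesis unfolding W_def using True by simp
next
  case False
  have "W (\<rho>(e := t)) v = W \<rho> v" by (rule W_cong) (use False in auto)
  then show ?thesis using False by simp
qed

lemma W_diff:
  "W \<rho> u - W \<rho> v =
    (\<Sum>e\<in>E. ((if u \<in> N e then 1 else 0) - (if v \<in> N e then 1 else 0)) * \<rho> e)"
proof -
  have "W \<rho> v = (\<Sum>e\<in>E. (if v \<in> N e then 1 else 0) * \<rho> e)" for v
    unfolding W_def using finE by (simp add: sum.inter_filter if_distrib[of "\<lambda>x. x * _"] cong: if_cong)
  then show ?thesis by (simp add: left_diff_distrib sum_subtractf)
qed

lemma W_diff_cong:
  assumes "\<And>e. e \<in> E \<Longrightarrow> (u \<in> N e) \<noteq> (v \<in> N e) \<Longrightarrow> \<rho> e = \<rho>' e"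
  shows "W \<rho> u - W \<rho> v = W \<rho>' u - W \<rho>' v"
  unfolding W_diff by (rule sum.cong) (use assms in auto)

lemma proper_mono: "proper \<rho> S e \<Longrightarrow> S \<subseteq> S' \<Longrightarrow> proper \<rho> S' e"
  unfolding proper_def by blast

lemma proper_cong: "(\<And>v. v \<in> S \<Longrightarrow> W \<rho> v = W \<rho>' v) \<Longrightarrow> proper \<rho> S e \<longleftrightarrow> proper \<rho>' S e"
  unfolding proper_def by auto

text \<open>Transfer of the ordered result: vertices become positions, and edges are seen through
  their trace on the list. By \<open>fwd\<close> each vertex comes first in some edge, or is last
  and has two neighbours in the list.\<close>

lemma reweight_list:
  assumes dist: "distinct vs" and F: "F \<subseteq> E"
    and fwd: "\<And>xs u ys. vs = xs @ u # ys \<Longrightarrow> (\<exists>e\<in>F. u \<in> N e \<and> N e \<inter> set xs = {}) \<or>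
      ys = [] \<and> (\<exists>e\<in>F. \<exists>e'\<in>F. \<exists>a a'. a \<noteq> a' \<and> a \<noteq> u \<and> a' \<noteq> u \<and>
        N e \<inter> set vs = {a, u} \<and> N e' \<inter> set vs = {a', u})"
  shows "\<exists>\<rho>. (\<forall>e. e \<notin> F \<longrightarrow> \<rho> e = \<rho>\<^sub>0 e) \<and> (\<forall>e\<in>F. \<rho> e \<in> {1..5}) \<and>
    (\<forall>e\<in>F. 2 \<le> card (N e \<inter> set vs) \<longrightarrow> proper \<rho> (set vs) e)"
proof -
  define n where "n = length vs"
  define M where "M e = {i. i < n \<and> vs ! i \<in> N e}" for e
  define f where "f e = Min (M e)" for e
  \<comment> \<open>The length \<open>n\<close> stands for a missing second vertex.\<close>
  define g where "g e = (if 2 \<le> card (M e) then Min (M e - {f e}) else n)" for e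
  define E1 where "E1 = {e \<in> F. N e \<inter> set vs \<noteq> {}}"
  have finM: "finite (M e)" for e unfolding M_def by simp
  have img: "N e \<inter> set vs = (!) vs ` M e" for e
    unfolding M_def n_def by (auto simp: in_set_conv_nth)
  have inj: "inj_on ((!) vs) (M e)" for e
    using dist unfolding M_def n_def by (auto simp: inj_on_def nth_eq_iff_index_eq)
  have cardM: "card (N e \<inter> set vs) = card (M e)" for e
    unfolding img by (rule card_image[OF inj])
  have ne: "M e \<noteq> {}" if "e \<in> E1" for e using that img[of e] unfolding E1_def by auto
  have fM: "f e \<in> M e" if "e \<in> E1" for e unfolding f_def by (rule Min_in[OF finM ne[OF that]])
  have second_in: "g e \<in> M e - {f e}" if "e \<in> E1" "2 \<le> card (M e)" for e
  proof -
    have "M e - {f e} \<noteq> {}" using that(2) card_mono[of "{f e}" "M e"] by auto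
    then show ?thesis unfolding g_def using that(2) Min_in[of "M e - {f e}"] finM by auto
  qed
  have gn: "2 \<le> card (M e)" if "g e < n" for e using that unfolding g_def by (auto split: if_splits)
  interpret ordered_edges E E1 M f g n
  proof
    show "f e < g e" if "e \<in> E1" for e
    proof (cases "2 \<le> card (M e)")
      case True
      have "f e \<le> g e" unfolding f_def by (rule Min_le[OF finM]) (use second_in[OF that True] in auto)
      then show ?thesis using second_in[OF that True] by auto
    next
      case False then show ?thesis using fM[OF that] unfolding g_def M_def by auto
    qed
    show "g e \<in> M e" if "e \<in> E1" "g e < n" for e using second_in[OF that(1) gn[OF that(2)]] by simp
    show "i = f e \<or> g e \<le> i" if e: "e \<in> E1" "i \<in> M e" "i < n" for e i
    proof (cases "i = f e")
      case False
      then have "{i, f e} \<subseteq> M e" using e fM by auto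
      then have "2 \<le> card (M e)" using card_mono[OF finM, of "{i, f e}" e] False by simp
      then show ?thesis using e False finM unfolding g_def by auto
    qed simp
  qed (use finE F fM in \<open>auto simp: E1_def\<close>)
  have "(\<exists>e\<in>E1. f e = k) \<or> Suc k = n \<and> (\<exists>e\<in>E1. \<exists>e'\<in>E1. g e = k \<and> g e' = k \<and> f e \<noteq> f e')"
    if k: "k < n" for k
  proof -
    have "vs = take k vs @ vs ! k # drop (Suc k) vs" using k unfolding n_def by (rule id_take_nth_drop)
    from fwd[OF this] show ?thesis
    proof
      assume "\<exists>e\<in>F. vs ! k \<in> N e \<and> N e \<inter> set (take k vs) = {}"
      then obtain e where e: "e \<in> F" "vs ! k \<in> N e" "N e \<inter> set (take k vs) = {}" by blast
      have kM: "k \<in> M e" using k e(2) unfolding M_def by simp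
      then have "e \<in> E1" using e(1) img[of e] unfolding E1_def by auto
      moreover have "f e = k" unfolding f_def
      proof (rule Min_eqI[OF finM _ kM])
        fix i assume i: "i \<in> M e"
        show "k \<le> i"
        proof (rule ccontr)
          assume "\<not> k \<le> i"
          then have "i < length (take k vs)" "take k vs ! i = vs ! i" using k unfolding n_def by auto
          then have "vs ! i \<in> set (take k vs)" by (metis nth_mem)
          then show False using e(3) i unfolding M_def by auto
        qed
      qed
      ultimately show ?thesis by blast
    next
      assume "drop (Suc k) vs = [] \<and> (\<exists>e\<in>F. \<exists>e'\<in>F. \<exists>a a'. a \<noteq> a' \<and> a \<noteq> vs ! k \<and> a' \<noteq> vs ! k \<and>
        N e \<inter> set vs = {a, vs ! k} \<and> N e' \<inter> set vs = {a', vs ! k})"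
      then obtain e e' a a' where last: "Suc k = n"
        and ee: "e \<in> F" "e' \<in> F" "a \<noteq> a'" "a \<noteq> vs ! k" "a' \<noteq> vs ! k"
          "N e \<inter> set vs = {a, vs ! k}" "N e' \<inter> set vs = {a', vs ! k}"
        using k unfolding n_def by auto
      have two: "e \<in> E1 \<and> vs ! f e = a \<and> g e = k"
        if e: "e \<in> F" "a \<noteq> vs ! k" "N e \<inter> set vs = {a, vs ! k}" for e a
      proof -
        have "a \<in> (!) vs ` M e" using e(3) img[of e] by blast
        then obtain i where i: "i \<in> M e" "vs ! i = a" by blast
        have kM: "k \<in> M e" using k e(3) unfolding M_def by auto
        have "i < k" using i kM last e(2) unfolding M_def by (metis (mono_tags) less_antisym mem_Collect_eq)
        have "(!) vs ` M e = (!) vs ` {i, k}" using e(3) img[of e] i by simp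
        then have Me: "M e = {i, k}" using i kM inj by (metis (no_types, lifting) inj_on_image_eq_iff
              empty_subsetI insert_subset subset_refl)
        have "f e = i" unfolding f_def Me using \<open>i < k\<close> by simp
        moreover have "M e - {i} = {k}" unfolding Me using \<open>i < k\<close> by auto
        moreover have "card (M e) = 2" unfolding Me using \<open>i < k\<close> by simp
        ultimately have "g e = k" "vs ! f e = a" unfolding g_def using i by auto
        then show ?thesis using e unfolding E1_def by auto
      qed
      have "f e \<noteq> f e'" using two[OF ee(1,4,6)] two[OF ee(2,5,7)] ee(3) by auto
      then show ?thesis using two[OF ee(1,4,6)] two[OF ee(2,5,7)] last by blast
    qed
  qed
  \<comment> \<open>Edges of \<open>F\<close> that miss the list are not in \<open>E1\<close>; they
    start at 3 so that every edge of \<open>F\<close> has a value in \<open>{1..5}\<close>.\<close>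
  from exists_separating_weights[OF this, of "\<lambda>e. if e \<in> F then 3 else \<rho>\<^sub>0 e"]
  obtain \<rho> where \<rho>: "\<And>e. e \<notin> E1 \<Longrightarrow> \<rho> e = (if e \<in> F then 3 else \<rho>\<^sub>0 e)" "\<And>e. e \<in> E1 \<Longrightarrow> \<rho> e \<in> {1..5}"
    "\<And>e. e \<in> E1 \<Longrightarrow> g e < n \<Longrightarrow> wt \<rho> (f e) \<noteq> wt \<rho> (g e)" by blast
  have wtW: "wt \<rho> i = W \<rho> (vs ! i)" if "i < n" for i
    unfolding wt_def W_def M_def using that by simp
  show ?thesis
  proof (intro exI[of _ \<rho>] conjI allI ballI impI)
    fix e assume "e \<notin> F" then show "\<rho> e = \<rho>\<^sub>0 e" using \<rho>(1) unfolding E1_def by simp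
  next
    fix e assume "e \<in> F" then show "\<rho> e \<in> {1..5}" using \<rho>(1,2)[of e] by (cases "e \<in> E1") auto
  next
    fix e assume e: "e \<in> F" "2 \<le> card (N e \<inter> set vs)"
    then have e1: "e \<in> E1" unfolding E1_def by auto
    have g: "g e \<in> M e" using second_in[OF e1] e(2) cardM by auto
    then have "wt \<rho> (f e) \<noteq> wt \<rho> (g e)" using \<rho>(3)[OF e1] unfolding M_def by simp
    then have "W \<rho> (vs ! f e) \<noteq> W \<rho> (vs ! g e)" using wtW g fM[OF e1] unfolding M_def by simp
    moreover have "vs ! f e \<in> N e \<inter> set vs" "vs ! g e \<in> N e \<inter> set vs"
      unfolding img using g fM[OF e1] by auto
    ultimately show "proper \<rho> (set vs) e" unfolding proper_def by blast
  qed
qed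

section \<open>Removing part of a closed set\<close>

lemma exists_closed_remainder:
  assumes "finite Z"
  shows "\<exists>vs. distinct vs \<and> set vs \<subseteq> Z - S \<and> closed F (Z - S - set vs) \<and>
    (\<forall>xs u ys. vs = xs @ u # ys \<longrightarrow>
      (\<exists>e\<in>F. u \<in> N e \<and> N e \<inter> set xs = {} \<and> N e \<inter> (Z - S - set vs) = {}))"
  using assms
proof (induction "card (Z - S)" arbitrary: S rule: less_induct)
  case less
  show ?case
  proof (cases "closed F (Z - S)")
    case True then show ?thesis by (intro exI[of _ "[]"]) simp
  next
    case False
    \<comment> \<open>\<open>u\<close> is placed behind the vertices removed later. Its edge
      \<open>e\<close> meets \<open>Z - S\<close> only in \<open>u\<close>, hence avoids both the
      list before \<open>u\<close> and the remainder.\<close>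
    then obtain e u where e: "e \<in> F" "N e \<inter> (Z - S) = {u}"
      unfolding closed_def by (auto simp: card_1_singleton_iff)
    have "Z - insert u S \<subset> Z - S" using e(2) by blast
    then have "card (Z - insert u S) < card (Z - S)" using less.prems by (simp add: psubset_card_mono)
    from less.hyps[OF this less.prems] obtain vs where vs: "distinct vs" "set vs \<subseteq> Z - insert u S"
      "closed F (Z - insert u S - set vs)"
      "\<And>xs w ys. vs = xs @ w # ys \<Longrightarrow>
        \<exists>e\<in>F. w \<in> N e \<and> N e \<inter> set xs = {} \<and> N e \<inter> (Z - insert u S - set vs) = {}" by blast
    have eq: "Z - S - set (vs @ [u]) = Z - insert u S - set vs" by auto
    show ?thesis
    proof (intro exI[of _ "vs @ [u]"] conjI allI impI)
      show "distinct (vs @ [u])" "set (vs @ [u]) \<subseteq> Z - S" using vs(1,2) e(2) by auto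
      show "closed F (Z - S - set (vs @ [u]))" unfolding eq by (rule vs(3))
      fix xs w ys assume split: "vs @ [u] = xs @ w # ys"
      show "\<exists>e\<in>F. w \<in> N e \<and> N e \<inter> set xs = {} \<and> N e \<inter> (Z - S - set (vs @ [u])) = {}"
      proof (cases ys rule: rev_cases)
        case Nil
        then have "w = u" "xs = vs" using split by auto
        then show ?thesis using e vs(2) by (intro bexI[of _ e]) auto
      next
        case (snoc ys' y)
        then show ?thesis unfolding eq using vs(4)[of xs w ys'] split by auto
      qed
    qed
  qed
qed

text \<open>\<open>v\<close> is put at the end of the list, which must contain its two neighbours.
  Only edges missing the remainder \<open>Z'\<close> are changed, so weights on \<open>Z'\<close>
  persist; such an edge, if it meets \<open>Z\<close>, has two vertices in the list because
  \<open>Z\<close> is closed.\<close>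

lemma leaf_step:
  assumes Z: "finite Z" "closed F Z" and F: "F \<subseteq> E"
    and e1: "e1 \<in> F" "N e1 \<inter> Z = {a1, v}" "a1 \<noteq> v"
    and e2: "e2 \<in> F" "N e2 \<inter> Z = {a2, v}" "a2 \<noteq> v" and a: "a1 \<noteq> a2"
  obtains Z' where "Z' \<subset> Z" "closed F Z'"
    "\<And>\<rho>\<^sub>0. \<exists>\<rho>. (\<forall>e. e \<notin> F \<or> N e \<inter> Z' \<noteq> {} \<longrightarrow> \<rho> e = \<rho>\<^sub>0 e) \<and> (\<forall>e. \<rho> e = \<rho>\<^sub>0 e \<or> \<rho> e \<in> {1..5}) \<and>
      (\<forall>e\<in>F. N e \<inter> Z \<noteq> {} \<longrightarrow> N e \<inter> Z' = {} \<longrightarrow> proper \<rho> Z e)"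
proof -
  obtain vs where vs: "distinct vs" "set vs \<subseteq> Z - {v}" "closed F (Z - {v} - set vs)"
    "\<And>xs u ys. vs = xs @ u # ys \<Longrightarrow>
      \<exists>e\<in>F. u \<in> N e \<and> N e \<inter> set xs = {} \<and> N e \<inter> (Z - {v} - set vs) = {}"
    using exists_closed_remainder[OF Z(1), of "{v}" F] by blast
  define Z' where "Z' = Z - {v} - set vs"
  define F1 where "F1 = {e \<in> F. N e \<inter> Z' = {}}"
  have vZ: "v \<in> Z" using e1(2) by auto
  have leaf: "e \<in> F1 \<and> N e \<inter> set (vs @ [v]) = {a, v}"
    if e: "e \<in> F" "N e \<inter> Z = {a, v}" "a \<noteq> v" for e a
  proof -
    \<comment> \<open>Otherwise the edge would meet the closed remainder in \<open>a\<close>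
      alone.\<close>
    have "a \<in> set vs"
    proof (rule ccontr)
      assume "a \<notin> set vs"
      then have "N e \<inter> Z' = {a}" using e(2,3) unfolding Z'_def by auto
      then show False using vs(3) e(1) unfolding closed_def Z'_def by auto
    qed
    then show ?thesis using e vs(2) unfolding F1_def Z'_def by auto
  qed
  have re: "\<exists>\<rho>. (\<forall>e. e \<notin> F1 \<longrightarrow> \<rho> e = \<rho>\<^sub>0 e) \<and> (\<forall>e\<in>F1. \<rho> e \<in> {1..5}) \<and>
    (\<forall>e\<in>F1. 2 \<le> card (N e \<inter> set (vs @ [v])) \<longrightarrow> proper \<rho> (set (vs @ [v])) e)" for \<rho>\<^sub>0
  proof (rule reweight_list)
    show "distinct (vs @ [v])" "F1 \<subseteq> E" using vs(1,2) F unfolding F1_def by auto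
    fix xs u ys assume split: "vs @ [v] = xs @ u # ys"
    show "(\<exists>e\<in>F1. u \<in> N e \<and> N e \<inter> set xs = {}) \<or>
      ys = [] \<and> (\<exists>e\<in>F1. \<exists>e'\<in>F1. \<exists>a a'. a \<noteq> a' \<and> a \<noteq> u \<and> a' \<noteq> u \<and>
        N e \<inter> set (vs @ [v]) = {a, u} \<and> N e' \<inter> set (vs @ [v]) = {a', u})"
    proof (cases ys rule: rev_cases)
      case Nil
      then have "u = v" using split by auto
      then show ?thesis using Nil leaf[OF e1] leaf[OF e2] a e1(3) e2(3) by blast
    next
      case (snoc ys' y)
      then have "vs = xs @ u # ys'" using split by auto
      from vs(4)[OF this] show ?thesis unfolding F1_def Z'_def by auto
    qed
  qed
  show thesis
  proof (rule that)
    show "Z' \<subset> Z" "closed F Z'" using vZ vs(3) unfolding Z'_def by auto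
    fix \<rho>\<^sub>0
    obtain \<rho> where \<rho>: "\<And>e. e \<notin> F1 \<Longrightarrow> \<rho> e = \<rho>\<^sub>0 e" "\<And>e. e \<in> F1 \<Longrightarrow> \<rho> e \<in> {1..5}"
      "\<And>e. e \<in> F1 \<Longrightarrow> 2 \<le> card (N e \<inter> set (vs @ [v])) \<Longrightarrow> proper \<rho> (set (vs @ [v])) e"
      using re[of \<rho>\<^sub>0] by blast
    have "proper \<rho> Z e" if e: "e \<in> F" "N e \<inter> Z \<noteq> {}" "N e \<inter> Z' = {}" for e
    proof -
      have eq: "N e \<inter> set (vs @ [v]) = N e \<inter> Z" using e(3) vs(2) vZ unfolding Z'_def by auto
      have "card (N e \<inter> Z) \<noteq> 0" "card (N e \<inter> Z) \<noteq> 1" using e Z unfolding closed_def by auto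
      then have "proper \<rho> (set (vs @ [v])) e" using \<rho>(3)[of e] e unfolding eq F1_def by auto
      then show ?thesis by (rule proper_mono) (use vs(2) vZ in auto)
    qed
    then show "\<exists>\<rho>. (\<forall>e. e \<notin> F \<or> N e \<inter> Z' \<noteq> {} \<longrightarrow> \<rho> e = \<rho>\<^sub>0 e) \<and> (\<forall>e. \<rho> e = \<rho>\<^sub>0 e \<or> \<rho> e \<in> {1..5}) \<and>
      (\<forall>e\<in>F. N e \<inter> Z \<noteq> {} \<longrightarrow> N e \<inter> Z' = {} \<longrightarrow> proper \<rho> Z e)"
      using \<rho>(1,2) unfolding F1_def by (intro exI[of _ \<rho>]) blast
  qed
qed

end

text \<open>Here the edges meeting \<open>X\<close> in two vertices form a perfect matching of \<open>X\<close>. The weights of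
  the matching edges do not affect the difference between the two vertices of a pair.\<close>

locale matched = twin_free R E N m for R :: "'v set" and E :: "'e set" and N m +
  fixes X :: "'v set" and \<pi> :: "'v \<Rightarrow> 'v"
  assumes XR: "X \<subseteq> R" and closedX: "closed E X"
    and pi_in: "x \<in> X \<Longrightarrow> \<pi> x \<in> X" and pi_pi: "x \<in> X \<Longrightarrow> \<pi> (\<pi> x) = x"
    and pi_ne: "x \<in> X \<Longrightarrow> \<pi> x \<noteq> x"
    and pair_edge: "x \<in> X \<Longrightarrow> \<exists>e\<in>E. N e \<inter> X = {x, \<pi> x}"
begin

text \<open>Edges containing a whole pair become proper once all pairs are separated; these are the
  ones that need separate care.\<close>

definition half :: "'e set" where
  "half = {e \<in> E. N e \<inter> X \<noteq> {} \<and> (\<forall>x\<in>X. x \<in> N e \<longrightarrow> \<pi> x \<notin> N e)}"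

definition matching :: "'e set" where
  "matching = {e \<in> E. \<exists>x\<in>X. N e \<inter> X = {x, \<pi> x}}"

lemma finX: "finite X"
  using finite_subset[OF XR finR] .

lemma free_sub: "half \<union> matching \<subseteq> E"
  unfolding half_def matching_def by auto

lemma halfD: "e \<in> half \<Longrightarrow> x \<in> X \<Longrightarrow> x \<in> N e \<Longrightarrow> \<pi> x \<notin> N e"
  unfolding half_def by blast

lemma obtain_pair_edge:
  assumes "x \<in> X"
  obtains e where "e \<in> matching" "N e \<inter> X = {x, \<pi> x}"
  using pair_edge[OF assms] assms unfolding matching_def by blast

text \<open>The matching edge at \<open>x\<close> would otherwise meet \<open>Z\<close> in
  \<open>x\<close> alone.\<close>

lemma pi_closed:
  assumes Z: "Z \<subseteq> X" "closed (half \<union> matching) Z" and x: "x \<in> Z"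
  shows "\<pi> x \<in> Z"
proof (rule ccontr)
  assume n: "\<pi> x \<notin> Z"
  obtain e where e: "e \<in> matching" "N e \<inter> X = {x, \<pi> x}" using obtain_pair_edge x Z(1) by blast
  have "N e \<inter> Z = (N e \<inter> X) \<inter> Z" using Z(1) by blast
  also have "\<dots> = {x}" unfolding e(2) using n x by blast
  finally have "card (N e \<inter> Z) = 1" by simp
  then show False using Z(2) e(1) unfolding closed_def by blast
qed

text \<open>Hence changing a matching edge never alters the weight difference inside a pair.\<close>

lemma pair_indistinct:
  assumes "x \<in> X" "N e \<inter> X = {x, \<pi> x}" "c \<in> X"
  shows "c \<in> N e \<longleftrightarrow> \<pi> c \<in> N e"
proof -
  have "c \<in> N e \<longleftrightarrow> c \<in> {x, \<pi> x}" "\<pi> c \<in> N e \<longleftrightarrow> \<pi> c \<in> {x, \<pi> x}"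
    unfolding assms(2)[symmetric] using assms(3) pi_in by auto
  then show ?thesis using pi_pi[OF assms(1)] pi_pi[OF assms(3)] by auto
qed

lemma proper_pair:
  assumes "N e \<inter> S = {x, \<pi> x}" "proper \<rho> S e"
  shows "W \<rho> x \<noteq> W \<rho> (\<pi> x)"
  using assms unfolding proper_def by auto

text \<open>\<open>h\<close> contains exactly one vertex of each pair it meets, so its value shifts
  all these differences equally, and each of fewer than \<open>m\<close> pairs forbids only one
  value.\<close>

lemma separate_pairs_of_half_edge:
  assumes h: "h \<in> half"
  shows "\<exists>t\<in>{1..int m}. \<forall>x\<in>N h \<inter> X. W (\<rho>(h := t)) x \<noteq> W (\<rho>(h := t)) (\<pi> x)"
proof -
  have hE: "h \<in> E" using h unfolding half_def by simp
  have fin: "finite (N h)" using finite_subset[OF NR[OF hE] finR] .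
  have "card (N h \<inter> X) < m" using card_mono[OF fin, of "N h \<inter> X"] cardN[OF hE] by auto
  then have "\<exists>t\<in>{1..int m}. \<forall>x\<in>N h \<inter> X. W \<rho> x - W \<rho> (\<pi> x) - \<rho> h + 1 * t \<noteq> 0"
    using fin by (intro exists_avoiding_value) auto
  then obtain t where t: "t \<in> {1..int m}"
    "\<And>x. x \<in> N h \<inter> X \<Longrightarrow> W \<rho> x - W \<rho> (\<pi> x) - \<rho> h + t \<noteq> 0" by auto
  have "W (\<rho>(h := t)) x \<noteq> W (\<rho>(h := t)) (\<pi> x)" if x: "x \<in> N h \<inter> X" for x
    using t(2)[OF x] halfD[OF h, of x] x unfolding W_upd[OF hE] by simp
  then show ?thesis using t(1) by blast
qed

text \<open>The matching edge of a pair shifts both of its weights together and leaves the other two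
  pairs alone, so it remains to shift three pairs of integers.\<close>

lemma separate_three_pairs_of_vertices:
  assumes X: "x \<in> X" "y \<in> X" "z \<in> X"
    and disj: "{x, \<pi> x} \<inter> {y, \<pi> y} = {}" "{x, \<pi> x} \<inter> {z, \<pi> z} = {}" "{y, \<pi> y} \<inter> {z, \<pi> z} = {}"
    and ne: "W \<rho> x \<noteq> W \<rho> (\<pi> x)" "W \<rho> y \<noteq> W \<rho> (\<pi> y)" "W \<rho> z \<noteq> W \<rho> (\<pi> z)"
  obtains \<rho>' where "\<And>e. \<rho>' e = \<rho> e \<or> \<rho>' e \<in> {1..5}"
    "\<And>e. \<rho>' e \<noteq> \<rho> e \<Longrightarrow> e \<in> matching \<and> (\<exists>w\<in>{x, y, z}. N e \<inter> X = {w, \<pi> w})"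
    "\<And>u v w w'. u \<in> {w, \<pi> w} \<Longrightarrow> v \<in> {w', \<pi> w'} \<Longrightarrow> w \<in> {x, y, z} \<Longrightarrow> w' \<in> {x, y, z} \<Longrightarrow> w \<noteq> w' \<Longrightarrow>
      W \<rho>' u \<noteq> W \<rho>' v"
proof -
  obtain a where a: "a \<in> matching" "N a \<inter> X = {x, \<pi> x}" by (rule obtain_pair_edge[OF X(1)])
  obtain b where b: "b \<in> matching" "N b \<inter> X = {y, \<pi> y}" by (rule obtain_pair_edge[OF X(2)])
  obtain c where c: "c \<in> matching" "N c \<inter> X = {z, \<pi> z}" by (rule obtain_pair_edge[OF X(3)])
  have abc: "a \<in> E" "b \<in> E" "c \<in> E" "a \<noteq> b" "a \<noteq> c" "b \<noteq> c"
    using a b c disj unfolding matching_def by auto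
  have "W \<rho> x - \<rho> a \<noteq> W \<rho> (\<pi> x) - \<rho> a" "W \<rho> y - \<rho> b \<noteq> W \<rho> (\<pi> y) - \<rho> b"
    "W \<rho> z - \<rho> c \<noteq> W \<rho> (\<pi> z) - \<rho> c" using ne by simp_all
  note diffs = this
  obtain i j k where ijk: "i \<in> {1..5}" "j \<in> {1..5}" "k \<in> {1..5}"
    and dis: "{W \<rho> x - \<rho> a + i, W \<rho> (\<pi> x) - \<rho> a + i} \<inter> {W \<rho> y - \<rho> b + j, W \<rho> (\<pi> y) - \<rho> b + j} = {}"
      "{W \<rho> x - \<rho> a + i, W \<rho> (\<pi> x) - \<rho> a + i} \<inter> {W \<rho> z - \<rho> c + k, W \<rho> (\<pi> z) - \<rho> c + k} = {}"
      "{W \<rho> y - \<rho> b + j, W \<rho> (\<pi> y) - \<rho> b + j} \<inter> {W \<rho> z - \<rho> c + k, W \<rho> (\<pi> z) - \<rho> c + k} = {}"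
    by (rule separate_three_pairs[OF diffs]) (rule that)
  define \<rho>' where "\<rho>' = \<rho>(a := i, b := j, c := k)"
  have W': "W \<rho>' v = W \<rho> v + (if v \<in> N a then i - \<rho> a else 0) + (if v \<in> N b then j - \<rho> b else 0)
      + (if v \<in> N c then k - \<rho> c else 0)" for v
    unfolding \<rho>'_def using abc by (simp add: W_upd)
  have mem: "v \<in> N a \<longleftrightarrow> v \<in> {x, \<pi> x}" "v \<in> N b \<longleftrightarrow> v \<in> {y, \<pi> y}" "v \<in> N c \<longleftrightarrow> v \<in> {z, \<pi> z}"
    if "v \<in> X" for v using that by (simp_all only: a(2)[symmetric] b(2)[symmetric] c(2)[symmetric] Int_iff simp_thms)
  have Wx: "W \<rho>' v = W \<rho> v - \<rho> a + i" if "v \<in> {x, \<pi> x}" for v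
  proof -
    have "v \<in> X" using that X(1) pi_in by auto
    moreover have "v \<notin> {y, \<pi> y}" "v \<notin> {z, \<pi> z}" using that disj by blast+
    ultimately show ?thesis unfolding W' using mem[of v] that by simp
  qed
  have Wy: "W \<rho>' v = W \<rho> v - \<rho> b + j" if "v \<in> {y, \<pi> y}" for v
  proof -
    have "v \<in> X" using that X(2) pi_in by auto
    moreover have "v \<notin> {x, \<pi> x}" "v \<notin> {z, \<pi> z}" using that disj by blast+
    ultimately show ?thesis unfolding W' using mem[of v] that by simp
  qed
  have Wz: "W \<rho>' v = W \<rho> v - \<rho> c + k" if "v \<in> {z, \<pi> z}" for v
  proof -
    have "v \<in> X" using that X(3) pi_in by auto
    moreover have "v \<notin> {x, \<pi> x}" "v \<notin> {y, \<pi> y}" using that disj by blast+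
    ultimately show ?thesis unfolding W' using mem[of v] that by simp
  qed
  have Wmem: "W \<rho>' v \<in> {W \<rho> x - \<rho> a + i, W \<rho> (\<pi> x) - \<rho> a + i}" if "v \<in> {x, \<pi> x}" for v
    using Wx[OF that] that by blast
  have Wmem': "W \<rho>' v \<in> {W \<rho> y - \<rho> b + j, W \<rho> (\<pi> y) - \<rho> b + j}" if "v \<in> {y, \<pi> y}" for v
    using Wy[OF that] that by blast
  have Wmem'': "W \<rho>' v \<in> {W \<rho> z - \<rho> c + k, W \<rho> (\<pi> z) - \<rho> c + k}" if "v \<in> {z, \<pi> z}" for v
    using Wz[OF that] that by blast
  show thesis
  proof (rule that[of \<rho>'])
    show "\<rho>' e = \<rho> e \<or> \<rho>' e \<in> {1..5}" for e using ijk unfolding \<rho>'_def by auto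
    show "e \<in> matching \<and> (\<exists>w\<in>{x, y, z}. N e \<inter> X = {w, \<pi> w})" if "\<rho>' e \<noteq> \<rho> e" for e
    proof -
      have "e = a \<or> e = b \<or> e = c" using that unfolding \<rho>'_def by (metis fun_upd_other)
      then show ?thesis using a b c by blast
    qed
    fix u v w w'
    assume uv: "u \<in> {w, \<pi> w}" "v \<in> {w', \<pi> w'}" "w \<in> {x, y, z}" "w' \<in> {x, y, z}" "w \<noteq> w'"
    then consider "w = x" "w' = y" | "w = x" "w' = z" | "w = y" "w' = z"
      | "w = y" "w' = x" | "w = z" "w' = x" | "w = z" "w' = y" by blast
    then show "W \<rho>' u \<noteq> W \<rho>' v"
    proof cases
      case 1 then show ?thesis using Wmem[of u] Wmem'[of v] uv(1,2) dis(1) by (metis disjoint_iff)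
    next
      case 2 then show ?thesis using Wmem[of u] Wmem''[of v] uv(1,2) dis(2) by (metis disjoint_iff)
    next
      case 3 then show ?thesis using Wmem'[of u] Wmem''[of v] uv(1,2) dis(3) by (metis disjoint_iff)
    next
      case 4 then show ?thesis using Wmem[of v] Wmem'[of u] uv(1,2) dis(1) by (metis disjoint_iff)
    next
      case 5 then show ?thesis using Wmem[of v] Wmem''[of u] uv(1,2) dis(2) by (metis disjoint_iff)
    next
      case 6 then show ?thesis using Wmem'[of v] Wmem''[of u] uv(1,2) dis(3) by (metis disjoint_iff)
    qed
  qed
qed

text \<open>Only pairs met by half edges are required to differ: the others are separated by the
  initial weighting, and their differences persist, since only half and matching edges are
  reweighted.\<close>

definition settled :: "('e \<Rightarrow> int) \<Rightarrow> 'v set \<Rightarrow> bool" where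
  "settled \<rho> Z \<longleftrightarrow> (\<forall>e\<in>half. N e \<inter> Z \<noteq> {} \<longrightarrow> proper \<rho> Z e) \<and>
     (\<forall>e\<in>half. \<forall>x\<in>N e \<inter> Z. W \<rho> x \<noteq> W \<rho> (\<pi> x))"

text \<open>The matching edge at \<open>b\<close> makes \<open>\<pi> b\<close> a second neighbour of \<open>b\<close>, besides \<open>a\<close>.\<close>

lemma settle_small:
  assumes Z: "Z \<subseteq> X" "closed (half \<union> matching) Z"
    and h: "h \<in> half" "N h \<inter> Z = {a, b}" "a \<noteq> b"
  obtains Z' where "Z' \<subset> Z" "closed (half \<union> matching) Z'"
    "\<And>\<rho>\<^sub>0. settled \<rho>\<^sub>0 Z' \<Longrightarrow> \<exists>\<rho>. (\<forall>e. e \<notin> half \<union> matching \<longrightarrow> \<rho> e = \<rho>\<^sub>0 e) \<and>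
      (\<forall>e. \<rho> e = \<rho>\<^sub>0 e \<or> \<rho> e \<in> {1..5}) \<and> settled \<rho> Z"
proof -
  let ?F = "half \<union> matching"
  have finZ: "finite Z" using finite_subset[OF Z(1) finX] .
  have bX: "b \<in> X" "b \<in> Z" "a \<in> X" using h(2) Z(1) by auto
  obtain t where t: "t \<in> matching" "N t \<inter> X = {b, \<pi> b}" by (rule obtain_pair_edge[OF bX(1)])
  have "N t \<inter> Z = N t \<inter> X \<inter> Z" using Z(1) by blast
  then have tZ: "N t \<inter> Z = {\<pi> b, b}" unfolding t(2) using bX pi_closed[OF Z bX(2)] by blast
  have ab: "a \<noteq> \<pi> b" using halfD[OF h(1) bX(1)] h(2) by blast
  have "h \<in> ?F" "t \<in> ?F" using h(1) t(1) by auto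
  note hyps = finZ Z(2) free_sub this(1) h(2,3) this(2) tZ pi_ne[OF bX(1)] ab
  obtain Z' where Z': "Z' \<subset> Z" "closed ?F Z'"
    and re: "\<And>\<rho>\<^sub>0. \<exists>\<rho>. (\<forall>e. e \<notin> ?F \<or> N e \<inter> Z' \<noteq> {} \<longrightarrow> \<rho> e = \<rho>\<^sub>0 e) \<and>
      (\<forall>e. \<rho> e = \<rho>\<^sub>0 e \<or> \<rho> e \<in> {1..5}) \<and>
      (\<forall>e\<in>?F. N e \<inter> Z \<noteq> {} \<longrightarrow> N e \<inter> Z' = {} \<longrightarrow> proper \<rho> Z e)"
    by (rule leaf_step[OF hyps]) (rule that)
  have Z'X: "Z' \<subseteq> X" using Z'(1) Z(1) by blast
  show thesis
  proof (rule that[OF Z'])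
    fix \<rho>\<^sub>0 assume IH: "settled \<rho>\<^sub>0 Z'"
    obtain \<rho> where \<rho>: "\<And>e. e \<notin> ?F \<Longrightarrow> \<rho> e = \<rho>\<^sub>0 e" "\<And>e. N e \<inter> Z' \<noteq> {} \<Longrightarrow> \<rho> e = \<rho>\<^sub>0 e"
      "\<And>e. \<rho> e = \<rho>\<^sub>0 e \<or> \<rho> e \<in> {1..5}"
      "\<And>e. e \<in> ?F \<Longrightarrow> N e \<inter> Z \<noteq> {} \<Longrightarrow> N e \<inter> Z' = {} \<Longrightarrow> proper \<rho> Z e" using re[of \<rho>\<^sub>0] by blast
    have same: "W \<rho> v = W \<rho>\<^sub>0 v" if "v \<in> Z'" for v
      by (rule W_cong, rule \<rho>(2)) (use that in auto)
    have "proper \<rho> Z e" if e: "e \<in> half" "N e \<inter> Z \<noteq> {}" for e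
    proof (cases "N e \<inter> Z' = {}")
      case True then show ?thesis using \<rho>(4) e by blast
    next
      case False
      then have "proper \<rho>\<^sub>0 Z' e" using IH e unfolding settled_def by blast
      then have "proper \<rho> Z' e" using proper_cong[of Z' \<rho> \<rho>\<^sub>0] same by blast
      then show ?thesis by (rule proper_mono) (use Z' in auto)
    qed
    moreover have "W \<rho> x \<noteq> W \<rho> (\<pi> x)" if e: "e \<in> half" "x \<in> N e \<inter> Z" for e x
    proof (cases "x \<in> Z'")
      case True
      then have "W \<rho>\<^sub>0 x \<noteq> W \<rho>\<^sub>0 (\<pi> x)" using IH e unfolding settled_def by blast
      then show ?thesis using same True pi_closed[OF Z'X Z'(2) True] by simp
    next
      \<comment> \<open>Then \<open>\<pi> x\<close> is outside \<open>Z'\<close> too, so the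
        matching edge at \<open>x\<close> misses \<open>Z'\<close> and is proper; it meets
        \<open>Z\<close> in exactly this pair.\<close>
      case False
      have xX: "x \<in> X" using e Z(1) by auto
      have "\<pi> x \<notin> Z'" using False pi_closed[OF Z'X Z'(2), of "\<pi> x"] pi_pi[OF xX] by auto
      obtain s where s: "s \<in> matching" "N s \<inter> X = {x, \<pi> x}" by (rule obtain_pair_edge[OF xX])
      have "N s \<inter> Z' = (N s \<inter> X) \<inter> Z'" using Z'X by blast
      then have "N s \<inter> Z' = {}" unfolding s(2) using False \<open>\<pi> x \<notin> Z'\<close> by simp
      moreover have sZ: "N s \<inter> Z = {x, \<pi> x}" using s(2) Z(1) e(2) pi_closed[OF Z, of x] by blast
      ultimately have "proper \<rho> Z s" using \<rho>(4)[of s] s(1) by blast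
      then show ?thesis by (rule proper_pair[OF sZ])
    qed
    ultimately show "\<exists>\<rho>. (\<forall>e. e \<notin> ?F \<longrightarrow> \<rho> e = \<rho>\<^sub>0 e) \<and> (\<forall>e. \<rho> e = \<rho>\<^sub>0 e \<or> \<rho> e \<in> {1..5}) \<and> settled \<rho> Z"
      using \<rho>(1,3) unfolding settled_def by (intro exI[of _ \<rho>]) blast
  qed
qed

text \<open>The order \<open>vs\<close> avoids the \<open>s = card (N h \<inter> Z)\<close> pairs met by \<open>h\<close>. By minimality, a half edge with
  at most one vertex in \<open>vs\<close> and none in the remaining set \<open>Z'\<close> meets at least \<open>s - 1\<close> of these pairs,
  hence two of any three. So it is enough to separate every pair by the value of \<open>h\<close>, and then three
  of the pairs from each other by the values of their matching edges.\<close>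

lemma settle_large:
  assumes Z: "Z \<subseteq> X" "closed (half \<union> matching) Z"
    and h: "h \<in> half" "3 \<le> card (N h \<inter> Z)"
    and minimal: "\<And>e. e \<in> half \<Longrightarrow> N e \<inter> Z \<noteq> {} \<Longrightarrow> card (N h \<inter> Z) \<le> card (N e \<inter> Z)"
  obtains Z' where "Z' \<subset> Z" "closed (half \<union> matching) Z'"
    "\<And>\<rho>\<^sub>0. settled \<rho>\<^sub>0 Z' \<Longrightarrow> \<exists>\<rho>. (\<forall>e. e \<notin> half \<union> matching \<longrightarrow> \<rho> e = \<rho>\<^sub>0 e) \<and>
      (\<forall>e. \<rho> e = \<rho>\<^sub>0 e \<or> \<rho> e \<in> {1..int m}) \<and> settled \<rho> Z"
proof -
  let ?F = "half \<union> matching"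
  have finZ: "finite Z" using finite_subset[OF Z(1) finX] .
  \<comment> \<open>As \<open>h\<close> contains no pair, \<open>K\<close> has one vertex of each
    pair met by \<open>h\<close> and indexes these pairs; \<open>S\<close> is their union.\<close>
  define K where "K = N h \<inter> Z"
  define S where "S = K \<union> \<pi> ` K"
  have KX: "K \<subseteq> X" "K \<subseteq> Z" using Z(1) unfolding K_def by auto
  have finK: "finite K" using finite_subset[OF KX(2) finZ] .
  have piK: "\<pi> c \<notin> K" if "c \<in> K" for c using halfD[OF h(1), of c] that KX unfolding K_def by auto
  have SZ: "S \<subseteq> Z" using KX pi_closed[OF Z] unfolding S_def by auto
  have piS: "\<pi> c \<in> S" if "c \<in> S" for c using that pi_pi KX(1) unfolding S_def by auto
  obtain vs where vs: "distinct vs" "set vs \<subseteq> Z - S" "closed ?F (Z - S - set vs)"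
    "\<And>xs u ys. vs = xs @ u # ys \<Longrightarrow>
      \<exists>e\<in>?F. u \<in> N e \<and> N e \<inter> set xs = {} \<and> N e \<inter> (Z - S - set vs) = {}"
    using exists_closed_remainder[OF finZ, of S ?F] by blast
  define Z' where "Z' = Z - S - set vs"
  define F1 where "F1 = {e \<in> ?F. N e \<inter> Z' = {} \<and> N e \<inter> set vs \<noteq> {}}"
  have Z'X: "Z' \<subseteq> X" "Z' \<subseteq> Z" using Z(1) unfolding Z'_def by auto
  have clZ': "closed ?F Z'" using vs(3) unfolding Z'_def .
  have "K \<noteq> {}" using h(2) unfolding K_def by auto
  then have Z'Z: "Z' \<subset> Z" using KX unfolding Z'_def S_def by auto
  obtain T where T: "T \<subseteq> K" "card T = 3" using obtain_subset_with_card_n[OF h(2)] unfolding K_def by blast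
  then obtain x y z where T_eq: "T = {x, y, z}" and xyz: "x \<noteq> y" "x \<noteq> z" "y \<noteq> z"
    by (auto simp: card_3_iff)
  have xyzK: "x \<in> K" "y \<in> K" "z \<in> K" using T(1) unfolding T_eq by auto
  have pair_disj: "{u, \<pi> u} \<inter> {v, \<pi> v} = {}" if "u \<in> K" "v \<in> K" "u \<noteq> v" for u v
  proof -
    have "\<pi> u \<noteq> \<pi> v" using that pi_pi KX(1) by (metis subsetD)
    then show ?thesis using that piK by auto
  qed
  have re: "\<exists>\<rho>. (\<forall>e. e \<notin> F1 \<longrightarrow> \<rho> e = \<rho>\<^sub>0 e) \<and> (\<forall>e\<in>F1. \<rho> e \<in> {1..5}) \<and>
    (\<forall>e\<in>F1. 2 \<le> card (N e \<inter> set vs) \<longrightarrow> proper \<rho> (set vs) e)" for \<rho>\<^sub>0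
  proof (rule reweight_list[OF vs(1)])
    show "F1 \<subseteq> E" using free_sub unfolding F1_def by auto
    fix xs u ys assume split: "vs = xs @ u # ys"
    from vs(4)[OF split] obtain e where "e \<in> ?F" "u \<in> N e" "N e \<inter> set xs = {}" "N e \<inter> Z' = {}"
      unfolding Z'_def by auto
    moreover have "u \<in> set vs" using split by simp
    ultimately have "e \<in> F1" unfolding F1_def by blast
    then show "(\<exists>e\<in>F1. u \<in> N e \<and> N e \<inter> set xs = {}) \<or>
      ys = [] \<and> (\<exists>e\<in>F1. \<exists>e'\<in>F1. \<exists>a a'. a \<noteq> a' \<and> a \<noteq> u \<and> a' \<noteq> u \<and>
        N e \<inter> set vs = {a, u} \<and> N e' \<inter> set vs = {a', u})"
      using \<open>u \<in> N e\<close> \<open>N e \<inter> set xs = {}\<close> by blast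
  qed
  have hS: "N h \<inter> Z \<subseteq> S" unfolding S_def K_def by auto
  have hmeet: "N h \<inter> Z' = {}" "N h \<inter> set vs = {}" using hS Z'X vs(2) unfolding Z'_def by auto
  show thesis
  proof (rule that[OF Z'Z clZ'])
    fix \<rho>\<^sub>0 assume IH: "settled \<rho>\<^sub>0 Z'"
    obtain \<rho>1 where \<rho>1: "\<And>e. e \<notin> F1 \<Longrightarrow> \<rho>1 e = \<rho>\<^sub>0 e" "\<And>e. e \<in> F1 \<Longrightarrow> \<rho>1 e \<in> {1..5}"
      "\<And>e. e \<in> F1 \<Longrightarrow> 2 \<le> card (N e \<inter> set vs) \<Longrightarrow> proper \<rho>1 (set vs) e" using re[of \<rho>\<^sub>0] by blast
    \<comment> \<open>\<open>h\<close> meets \<open>Z\<close> only inside \<open>S\<close>, so this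
      change leaves the weights on the list and on \<open>Z'\<close> alone.\<close>
    obtain t where t: "t \<in> {1..int m}" "\<And>c. c \<in> N h \<inter> X \<Longrightarrow> W (\<rho>1(h := t)) c \<noteq> W (\<rho>1(h := t)) (\<pi> c)"
      using separate_pairs_of_half_edge[OF h(1)] by blast
    define \<rho>2 where "\<rho>2 = \<rho>1(h := t)"
    have sepK: "W \<rho>2 c \<noteq> W \<rho>2 (\<pi> c)" if "c \<in> K" for c
      using t(2)[of c] that KX unfolding \<rho>2_def K_def by auto
    \<comment> \<open>The three matching edges meet \<open>X\<close> only inside \<open>S\<close>,
      and they preserve the differences produced by \<open>t\<close>.\<close>
    obtain \<rho> where \<rho>: "\<And>e. \<rho> e = \<rho>2 e \<or> \<rho> e \<in> {1..5}"
      "\<And>e. \<rho> e \<noteq> \<rho>2 e \<Longrightarrow> e \<in> matching \<and> (\<exists>w\<in>{x, y, z}. N e \<inter> X = {w, \<pi> w})"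
      "\<And>u v w w'. u \<in> {w, \<pi> w} \<Longrightarrow> v \<in> {w', \<pi> w'} \<Longrightarrow> w \<in> {x, y, z} \<Longrightarrow> w' \<in> {x, y, z} \<Longrightarrow> w \<noteq> w' \<Longrightarrow>
        W \<rho> u \<noteq> W \<rho> v"
      by (rule separate_three_pairs_of_vertices[of x y z \<rho>2])
        (use xyzK KX xyz pair_disj sepK in auto)
    have changed: "N e \<inter> X = {w, \<pi> w} \<Longrightarrow> w \<in> K \<Longrightarrow> v \<in> X - S \<Longrightarrow> v \<notin> N e" for e w v
    proof
      assume "N e \<inter> X = {w, \<pi> w}" "w \<in> K" "v \<in> X - S" "v \<in> N e"
      moreover from this have "v \<in> {w, \<pi> w}" by (metis DiffD1 IntI)
      ultimately show False unfolding S_def by auto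
    qed
    have agree1: "\<rho> e = \<rho>1 e" if "v \<in> N e" "v \<in> Z - S" for e v
    proof -
      have "e \<noteq> h" using that hS by blast
      moreover have "\<rho> e = \<rho>2 e" using \<rho>(2)[of e] changed[of e _ v] that Z(1) xyzK by blast
      ultimately show ?thesis unfolding \<rho>2_def by simp
    qed
    have W1: "W \<rho> v = W \<rho>1 v" if "v \<in> Z - S" for v
      by (rule W_cong, rule agree1) (use that in auto)
    have W0: "W \<rho> v = W \<rho>\<^sub>0 v" if "v \<in> Z'" for v
    proof -
      have "W \<rho>1 v = W \<rho>\<^sub>0 v" by (rule W_cong, rule \<rho>1(1)) (use that in \<open>auto simp: F1_def\<close>)
      then show ?thesis using W1 that unfolding Z'_def by simp
    qed
    have propZ: "proper \<rho> Z e" if e: "e \<in> half" "N e \<inter> Z \<noteq> {}" for e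
    proof (cases "N e \<inter> Z' = {}")
      case False
      then have "proper \<rho>\<^sub>0 Z' e" using IH e unfolding settled_def by blast
      then have "proper \<rho> Z' e" using proper_cong[of Z' \<rho> \<rho>\<^sub>0] W0 by blast
      then show ?thesis by (rule proper_mono) (use Z'Z in auto)
    next
      case eZ': True
      show ?thesis
      proof (cases "2 \<le> card (N e \<inter> set vs)")
        case True
        then have "e \<in> F1" using e eZ' unfolding F1_def by auto
        then have "proper \<rho>1 (set vs) e" using \<rho>1(3) True by blast
        then have "proper \<rho> (set vs) e" using proper_cong[of "set vs" \<rho> \<rho>1] W1 vs(2) by blast
        then show ?thesis by (rule proper_mono) (use vs(2) in auto)
      next
        case few: False
        \<comment> \<open>\<open>D\<close> indexes the pairs of \<open>S\<close> met by
          \<open>e\<close>. By minimality of \<open>h\<close>, and since at most one vertex of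
          \<open>e\<close> is in the list, at most one pair is missed, so \<open>e\<close> meets two
          of the three separated pairs.\<close>
        define D where "D = {c \<in> K. c \<in> N e \<or> \<pi> c \<in> N e}"
        have "N e \<inter> Z \<subseteq> (N e \<inter> S) \<union> (N e \<inter> set vs)" using eZ' unfolding Z'_def by blast
        then have "card (N e \<inter> Z) \<le> card ((N e \<inter> S) \<union> (N e \<inter> set vs))"
          by (rule card_mono[rotated]) (use finite_subset[OF SZ finZ] in auto)
        also have "\<dots> \<le> card (N e \<inter> S) + card (N e \<inter> set vs)" by (rule card_Un_le)
        finally have c1: "card K \<le> card (N e \<inter> S) + 1"
          using minimal[OF e] few unfolding K_def by linarith
        define \<phi> where "\<phi> c = (if c \<in> K then c else \<pi> c)" for c
        have "\<phi> ` (N e \<inter> S) \<subseteq> D"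
          using pi_pi KX(1) unfolding \<phi>_def D_def S_def by auto
        moreover have "inj_on \<phi> (N e \<inter> S)"
        proof (rule inj_onI)
          fix c d assume cd: "c \<in> N e \<inter> S" "d \<in> N e \<inter> S" "\<phi> c = \<phi> d"
          have X: "c \<in> X" "d \<in> X" using cd SZ Z(1) by auto
          show "c = d" using cd(3) halfD[OF e(1) X(1)] halfD[OF e(1) X(2)] cd(1,2) pi_pi[OF X(1)] pi_pi[OF X(2)]
            unfolding \<phi>_def by (metis IntD1)
        qed
        ultimately have "card (N e \<inter> S) \<le> card D"
          using finK by (intro card_inj_on_le) (auto simp: D_def)
        then have "card (K - D) \<le> 1"
          using c1 card_Diff_subset[of D K] finK unfolding D_def by auto
        then have le1: "\<And>u v. u \<in> K - D \<Longrightarrow> v \<in> K - D \<Longrightarrow> u = v"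
          using finK card_le_Suc0_iff_eq[of "K - D"] by auto
        obtain u v where uv: "u \<in> {x, y, z}" "v \<in> {x, y, z}" "u \<noteq> v" "u \<in> D" "v \<in> D"
          using le1 xyz xyzK by (cases "x \<in> D"; cases "y \<in> D") blast+
        obtain u' v' where u'v': "u' \<in> {u, \<pi> u}" "u' \<in> N e" "v' \<in> {v, \<pi> v}" "v' \<in> N e"
          using uv(4,5) unfolding D_def by blast
        have "W \<rho> u' \<noteq> W \<rho> v'" by (rule \<rho>(3)[OF u'v'(1,3) uv(1,2,3)])
        moreover have "u' \<in> Z" "v' \<in> Z" using u'v' uv SZ unfolding D_def S_def by auto
        ultimately show ?thesis using u'v' unfolding proper_def by blast
      qed
    qed
    have diff: "W \<rho> c \<noteq> W \<rho> (\<pi> c)" if c: "c \<in> Z" "e \<in> half" "c \<in> N e" for c e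
    proof -
      have cX: "c \<in> X" using c Z(1) by auto
      \<comment> \<open>On \<open>Z'\<close> the assumption \<open>IH\<close> applies, a pair in the
        list is separated by its matching edge in \<open>F1\<close>, and a pair in \<open>S\<close>
        by the value of \<open>h\<close>.\<close>
      consider "c \<in> Z'" | "c \<in> set vs" | "c \<in> S" using c unfolding Z'_def by blast
      then show ?thesis
      proof cases
        case 1
        then have "W \<rho>\<^sub>0 c \<noteq> W \<rho>\<^sub>0 (\<pi> c)" using IH c unfolding settled_def by blast
        then show ?thesis using W0 1 pi_closed[OF Z'X(1) clZ' 1] by simp
      next
        case 2
        have nS: "c \<notin> S" "c \<notin> Z'" using 2 vs(2) unfolding Z'_def by auto
        have "\<pi> c \<notin> S" using nS(1) piS[of "\<pi> c"] pi_pi[OF cX] by auto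
        moreover have nZ': "\<pi> c \<notin> Z'" using nS(2) pi_closed[OF Z'X(1) clZ', of "\<pi> c"] pi_pi[OF cX] by auto
        ultimately have pc: "\<pi> c \<in> set vs" using pi_closed[OF Z c(1)] unfolding Z'_def by blast
        obtain s where s: "s \<in> matching" "N s \<inter> X = {c, \<pi> c}" by (rule obtain_pair_edge[OF cX])
        have sub: "set vs \<subseteq> X" using vs(2) Z(1) by blast
        have sv: "N s \<inter> set vs = {c, \<pi> c}" using s(2) sub 2 pc by blast
        have "N s \<inter> Z' = (N s \<inter> X) \<inter> Z'" using Z'X(1) by blast
        then have "N s \<inter> Z' = {}" unfolding s(2) using nS(2) nZ' by simp
        then have "s \<in> F1" using s(1) sv unfolding F1_def by auto
        moreover have "2 \<le> card (N s \<inter> set vs)" unfolding sv using pi_ne[OF cX] by auto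
        ultimately have "proper \<rho>1 (set vs) s" using \<rho>1(3) by blast
        then have "W \<rho>1 c \<noteq> W \<rho>1 (\<pi> c)" by (rule proper_pair[OF sv])
        then show ?thesis using W1 2 pc vs(2) by (metis subsetD)
      next
        case 3
        have delta: "W \<rho> c - W \<rho> (\<pi> c) = W \<rho>2 c - W \<rho>2 (\<pi> c)" if c: "c \<in> X" for c
        proof (rule W_diff_cong)
          fix e assume e: "e \<in> E" "(c \<in> N e) \<noteq> (\<pi> c \<in> N e)"
          have "\<not> (\<exists>w\<in>{x, y, z}. N e \<inter> X = {w, \<pi> w})"
          proof
            assume "\<exists>w\<in>{x, y, z}. N e \<inter> X = {w, \<pi> w}"
            then obtain w where "w \<in> K" "N e \<inter> X = {w, \<pi> w}" using xyzK by blast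
            then show False using pair_indistinct[of w e c] c KX e(2) by auto
          qed
          then show "\<rho> e = \<rho>2 e" using \<rho>(2)[of e] by auto
        qed
        obtain d where d: "d \<in> K" "c = d \<or> c = \<pi> d" using 3 unfolding S_def by auto
        have "W \<rho> d \<noteq> W \<rho> (\<pi> d)" using delta[of d] sepK[OF d(1)] d(1) KX by auto
        then show ?thesis using d pi_pi[of d] KX by auto
      qed
    qed
    show "\<exists>\<rho>. (\<forall>e. e \<notin> ?F \<longrightarrow> \<rho> e = \<rho>\<^sub>0 e) \<and> (\<forall>e. \<rho> e = \<rho>\<^sub>0 e \<or> \<rho> e \<in> {1..int m}) \<and> settled \<rho> Z"
    proof (intro exI[of _ \<rho>] conjI allI impI)
      fix e assume e: "e \<notin> ?F"
      then have "\<rho> e = \<rho>2 e" using \<rho>(2)[of e] by blast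
      moreover have "e \<noteq> h" "e \<notin> F1" using e h(1) unfolding F1_def by auto
      ultimately show "\<rho> e = \<rho>\<^sub>0 e" using \<rho>1(1) unfolding \<rho>2_def by simp
    next
      fix e
      have "\<rho>1 e = \<rho>\<^sub>0 e \<or> \<rho>1 e \<in> {1..5}" using \<rho>1(1,2) by blast
      then show "\<rho> e = \<rho>\<^sub>0 e \<or> \<rho> e \<in> {1..int m}"
        using \<rho>(1)[of e] t(1) m5 unfolding \<rho>2_def by (auto split: if_splits)
    next
      show "settled \<rho> Z" using propZ diff unfolding settled_def by blast
    qed
  qed
qed

text \<open>Induction on the size of \<open>Z\<close>: a half edge with the fewest vertices in
  \<open>Z\<close>, among those meeting it, decides which of the two reductions applies. Closedness
  excludes a single vertex.\<close>

lemma settle: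
  assumes "Z \<subseteq> X" "closed (half \<union> matching) Z" "\<And>e. \<rho>\<^sub>0 e \<in> {1..int m}"
  shows "\<exists>\<rho>. (\<forall>e. e \<notin> half \<union> matching \<longrightarrow> \<rho> e = \<rho>\<^sub>0 e) \<and> (\<forall>e. \<rho> e \<in> {1..int m}) \<and> settled \<rho> Z"
  using assms
proof (induction "card Z" arbitrary: Z rule: less_induct)
  case less
  let ?F = "half \<union> matching"
  note Z = less.prems(1,2)
  have finZ: "finite Z" using finite_subset[OF Z(1) finX] .
  show ?case
  proof (cases "\<exists>e\<in>half. N e \<inter> Z \<noteq> {}")
    case False
    then have "settled \<rho>\<^sub>0 Z" unfolding settled_def by blast
    then show ?thesis using less.prems(3) by blast
  next
    case True
    then obtain e0 where "e0 \<in> half \<and> N e0 \<inter> Z \<noteq> {}" by blast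
    from ex_has_least_nat[of "\<lambda>e. e \<in> half \<and> N e \<inter> Z \<noteq> {}", OF this, of "\<lambda>e. card (N e \<inter> Z)"]
    obtain h where h: "h \<in> half" "N h \<inter> Z \<noteq> {}"
      and minimal: "\<And>e. e \<in> half \<Longrightarrow> N e \<inter> Z \<noteq> {} \<Longrightarrow> card (N h \<inter> Z) \<le> card (N e \<inter> Z)" by blast
    have "card (N h \<inter> Z) \<noteq> 1" "card (N h \<inter> Z) \<noteq> 0" using h Z(2) finZ unfolding closed_def by auto
    then consider "card (N h \<inter> Z) = 2" | "3 \<le> card (N h \<inter> Z)" by linarith
    then obtain Z' where Z': "Z' \<subset> Z" "closed ?F Z'"
      and step: "\<And>\<rho>\<^sub>0. settled \<rho>\<^sub>0 Z' \<Longrightarrow> \<exists>\<rho>. (\<forall>e. e \<notin> ?F \<longrightarrow> \<rho> e = \<rho>\<^sub>0 e) \<and>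
        (\<forall>e. \<rho> e = \<rho>\<^sub>0 e \<or> \<rho> e \<in> {1..int m}) \<and> settled \<rho> Z"
    proof cases
      case 1
      then obtain a b where ab: "N h \<inter> Z = {a, b}" "a \<noteq> b" by (auto simp: card_2_iff)
      obtain Z' where Z': "Z' \<subset> Z" "closed ?F Z'"
        "\<And>\<rho>\<^sub>0. settled \<rho>\<^sub>0 Z' \<Longrightarrow> \<exists>\<rho>. (\<forall>e. e \<notin> ?F \<longrightarrow> \<rho> e = \<rho>\<^sub>0 e) \<and>
          (\<forall>e. \<rho> e = \<rho>\<^sub>0 e \<or> \<rho> e \<in> {1..5}) \<and> settled \<rho> Z" 
        by (rule settle_small[OF Z h(1) ab]) (rule that)
      have "{1..5} \<subseteq> {1..int m}" using m5 by auto
      then have "\<exists>\<rho>. (\<forall>e. e \<notin> ?F \<longrightarrow> \<rho> e = \<rho>\<^sub>0 e) \<and>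
          (\<forall>e. \<rho> e = \<rho>\<^sub>0 e \<or> \<rho> e \<in> {1..int m}) \<and> settled \<rho> Z" if "settled \<rho>\<^sub>0 Z'" for \<rho>\<^sub>0
        using Z'(3)[OF that] by blast
      then show thesis using that Z'(1,2) by blast
    next
      case 2
      show thesis by (rule settle_large[OF Z h(1) 2 minimal]) (use that in blast)+
    qed
    have "card Z' < card Z" using Z'(1) finZ by (simp add: psubset_card_mono)
    moreover have "Z' \<subseteq> X" using Z' Z by blast
    ultimately obtain \<rho>1 where \<rho>1: "\<And>e. e \<notin> ?F \<Longrightarrow> \<rho>1 e = \<rho>\<^sub>0 e" "\<And>e. \<rho>1 e \<in> {1..int m}" "settled \<rho>1 Z'"
      using less.hyps[of Z'] Z'(2) less.prems(3) by blast
    obtain \<rho> where "\<And>e. e \<notin> ?F \<Longrightarrow> \<rho> e = \<rho>1 e" "\<And>e. \<rho> e = \<rho>1 e \<or> \<rho> e \<in> {1..int m}" "settled \<rho> Z"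
      using step[OF \<rho>1(3)] by blast
    then show ?thesis using \<rho>1(1,2) by metis
  qed
qed

section \<open>Initial weights separating the matched pairs\<close>

lemma exists_half_of_pairs: "\<exists>Q\<subseteq>X. X \<subseteq> Q \<union> \<pi> ` Q \<and> Q \<inter> \<pi> ` Q = {}"
proof -
  obtain idx :: "'v \<Rightarrow> nat" where idx: "inj_on idx X"
    using finite_imp_inj_to_nat_seg[OF finX] by blast
  let ?Q = "{x \<in> X. idx x < idx (\<pi> x)}"
  have "x \<in> \<pi> ` ?Q" if x: "x \<in> X" "x \<notin> ?Q" for x
  proof (rule image_eqI)
    show "x = \<pi> (\<pi> x)" using pi_pi[OF x(1)] by simp
    have "idx x \<noteq> idx (\<pi> x)" using inj_onD[OF idx, of x "\<pi> x"] x(1) pi_in pi_ne by metis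
    then show "\<pi> x \<in> ?Q" using x pi_in pi_pi by auto
  qed
  moreover have "?Q \<inter> \<pi> ` ?Q = {}" using pi_pi by auto
  ultimately show ?thesis by (intro exI[of _ ?Q]) auto
qed

text \<open>An edge influences the difference of a pair only if it contains exactly one of its
  vertices, so it influences fewer than \<open>m\<close> pairs; every pair is influenced by some
  edge since \<open>R\<close> has no twins. The greedy choice therefore applies.\<close>

lemma separate_pairs_missed_by_half:
  "\<exists>\<rho>. (\<forall>e. \<rho> e \<in> {1..int m}) \<and>
    (\<forall>x\<in>X. (\<forall>e\<in>half. x \<notin> N e \<and> \<pi> x \<notin> N e) \<longrightarrow> W \<rho> x \<noteq> W \<rho> (\<pi> x))"
proof -
  obtain Q where Q: "Q \<subseteq> X" "X \<subseteq> Q \<union> \<pi> ` Q" "Q \<inter> \<pi> ` Q = {}" using exists_half_of_pairs by blast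
  define a :: "'v \<Rightarrow> 'e \<Rightarrow> int"
    where "a x e = (if x \<in> N e then 1 else 0) - (if \<pi> x \<in> N e then 1 else 0)" for x e
  have small: "card {x \<in> Q. a x e \<noteq> 0} < m" if e: "e \<in> E" for e
  proof -
    define \<phi> where "\<phi> x = (if x \<in> N e then x else \<pi> x)" for x
    have "inj_on \<phi> {x \<in> Q. a x e \<noteq> 0}"
    proof (rule inj_onI)
      fix x y assume xy: "x \<in> {x \<in> Q. a x e \<noteq> 0}" "y \<in> {x \<in> Q. a x e \<noteq> 0}" "\<phi> x = \<phi> y"
      then have "x \<noteq> \<pi> y" "y \<noteq> \<pi> x" "\<pi> (\<pi> x) = x" "\<pi> (\<pi> y) = y" using Q(1,3) pi_pi by auto
      then show "x = y" using xy(3) unfolding \<phi>_def by (metis)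
    qed
    moreover have "\<phi> ` {x \<in> Q. a x e \<noteq> 0} \<subseteq> N e" unfolding \<phi>_def a_def by auto
    moreover have "finite (N e)" using finite_subset[OF NR[OF e] finR] .
    ultimately have "card {x \<in> Q. a x e \<noteq> 0} \<le> card (N e)" by (rule card_inj_on_le)
    then show ?thesis using cardN[OF e] by simp
  qed
  have "0 < m" using m5 by simp
  have finQ: "finite Q" using finite_subset[OF Q(1) finX] .
  obtain \<rho> where \<rho>: "\<And>e. \<rho> e \<in> {1..int m}"
    "\<And>x. x \<in> Q \<Longrightarrow> \<exists>e\<in>E. a x e \<noteq> 0 \<Longrightarrow> 0 + (\<Sum>e\<in>E. a x e * \<rho> e) \<noteq> 0"
    using exists_weighting_avoiding_zero[OF finE finQ _ \<open>0 < m\<close>, of a "\<lambda>_. 0"] small by blast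
  have Qne: "W \<rho> x \<noteq> W \<rho> (\<pi> x)" if x: "x \<in> Q" for x
  proof -
    have xX: "x \<in> X" using x Q(1) by auto
    have "\<exists>e\<in>E. (x \<in> N e) \<noteq> (\<pi> x \<in> N e)"
      by (rule separated) (use xX XR pi_in[OF xX] pi_ne[OF xX] in auto)
    then obtain e where "e \<in> E" "(x \<in> N e) \<noteq> (\<pi> x \<in> N e)" by blast
    then have "\<exists>e\<in>E. a x e \<noteq> 0" by (intro bexI[of _ e]) (auto simp: a_def)
    then show ?thesis using \<rho>(2)[OF x] W_diff[of \<rho> x "\<pi> x"] unfolding a_def by simp
  qed
  have "W \<rho> x \<noteq> W \<rho> (\<pi> x)" if x: "x \<in> X" for x
  proof (cases "x \<in> Q")
    case False
    then obtain y where "y \<in> Q" "x = \<pi> y" using Q(2) x by blast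
    then show ?thesis using Qne[of y] pi_pi[of y] Q(1) by auto
  qed (rule Qne)
  then show ?thesis using \<rho>(1) by blast
qed

text \<open>The initial differences of pairs missed by all half edges survive the reweighting, so
  every pair ends up separated. Then edges containing a pair are proper, and the other edges meeting
  \<open>X\<close> are half edges.\<close>

lemma exists_proper_weighting_matched:
  "\<exists>\<rho>. (\<forall>e. \<rho> e \<in> {1..int m}) \<and> (\<forall>e\<in>E. N e \<inter> X \<noteq> {} \<longrightarrow> proper \<rho> X e)"
proof -
  obtain \<rho>\<^sub>0 where \<rho>0: "\<And>e. \<rho>\<^sub>0 e \<in> {1..int m}"
    "\<And>x. x \<in> X \<Longrightarrow> \<forall>e\<in>half. x \<notin> N e \<and> \<pi> x \<notin> N e \<Longrightarrow> W \<rho>\<^sub>0 x \<noteq> W \<rho>\<^sub>0 (\<pi> x)"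
    using separate_pairs_missed_by_half by blast
  have "closed (half \<union> matching) X" using closedX free_sub unfolding closed_def by blast
  from settle[OF subset_refl this, of \<rho>\<^sub>0] \<rho>0(1) obtain \<rho>
    where \<rho>: "\<And>e. e \<notin> half \<union> matching \<Longrightarrow> \<rho> e = \<rho>\<^sub>0 e" "\<And>e. \<rho> e \<in> {1..int m}" "settled \<rho> X" by blast
  have met: "W \<rho> x \<noteq> W \<rho> (\<pi> x)" if "x \<in> X" "e \<in> half" "x \<in> N e" for x e
    using \<rho>(3) that unfolding settled_def by blast
  have pairs: "W \<rho> x \<noteq> W \<rho> (\<pi> x)" if x: "x \<in> X" for x
  proof (cases "\<forall>e\<in>half. x \<notin> N e \<and> \<pi> x \<notin> N e")
    case True
    have "W \<rho> x - W \<rho> (\<pi> x) = W \<rho>\<^sub>0 x - W \<rho>\<^sub>0 (\<pi> x)"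
    proof (rule W_diff_cong)
      fix e assume e: "e \<in> E" "(x \<in> N e) \<noteq> (\<pi> x \<in> N e)"
      have "e \<notin> matching"
      proof
        assume "e \<in> matching"
        then obtain w where "w \<in> X" "N e \<inter> X = {w, \<pi> w}" unfolding matching_def by blast
        from pair_indistinct[OF this x] show False using e(2) by blast
      qed
      moreover have "e \<notin> half" using True e(2) by blast
      ultimately show "\<rho> e = \<rho>\<^sub>0 e" using \<rho>(1) by blast
    qed
    then show ?thesis using \<rho>0(2)[OF x True] by auto
  next
    case False
    then obtain e where "e \<in> half" "x \<in> N e \<or> \<pi> x \<in> N e" by blast
    then show ?thesis using met[of x e] met[of "\<pi> x" e] x pi_in[OF x] pi_pi[OF x] by auto
  qed
  have "proper \<rho> X e" if e: "e \<in> E" "N e \<inter> X \<noteq> {}" for e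
  proof (cases "e \<in> half")
    case True then show ?thesis using \<rho>(3) e unfolding settled_def by blast
  next
    case False
    then obtain x where x: "x \<in> X" "x \<in> N e" "\<pi> x \<in> N e" using e unfolding half_def by blast
    then show ?thesis using pairs[OF x(1)] pi_in[OF x(1)] unfolding proper_def by blast
  qed
  then show ?thesis using \<rho>(2) by blast
qed

end

section \<open>Induction over closed sets\<close>

context twin_free
begin

lemma exists_proper_weighting:
  assumes "Z \<subseteq> R" "closed E Z"
  shows "\<exists>\<rho>. (\<forall>e. \<rho> e \<in> {1..int m}) \<and> (\<forall>e\<in>E. N e \<inter> Z \<noteq> {} \<longrightarrow> proper \<rho> Z e)"
  using assms
proof (induction "card Z" arbitrary: Z rule: less_induct)
  case less
  note Z = less.prems
  have finZ: "finite Z" using finite_subset[OF Z(1) finR] .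
  define nb where "nb v u \<longleftrightarrow> u \<noteq> v \<and> (\<exists>e\<in>E. N e \<inter> Z = {u, v})" for v u
  consider v where "v \<in> Z" "\<And>u. \<not> nb v u" | v u w where "nb v u" "nb v w" "u \<noteq> w"
    | "\<And>v. v \<in> Z \<Longrightarrow> \<exists>!u. nb v u" by metis
  then show ?case
  proof cases
    case 1
    let ?Z = "Z - {v}"
    \<comment> \<open>An edge meeting the smaller set once either meets \<open>Z\<close> once or
      makes its vertex a neighbour of \<open>v\<close>; both are excluded.\<close>
    have cl: "closed E ?Z" unfolding closed_def
    proof
      fix e assume e: "e \<in> E"
      show "card (N e \<inter> ?Z) \<noteq> 1"
      proof
        assume "card (N e \<inter> ?Z) = 1"
        then obtain u where u: "N e \<inter> ?Z = {u}" by (auto simp: card_1_singleton_iff)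
        show False
        proof (cases "v \<in> N e")
          case True
          then have "N e \<inter> Z = {u, v}" using u 1(1) by auto
          then show False using 1(2)[of u] u e unfolding nb_def by auto
        next
          case False
          then have "N e \<inter> Z = {u}" using u by auto
          then show False using Z(2) e unfolding closed_def by (metis is_singletonI is_singleton_altdef)
        qed
      qed
    qed
    have "card ?Z < card Z" using finZ 1(1) by (rule card_Diff1_less)
    then obtain \<rho> where \<rho>: "\<And>e. \<rho> e \<in> {1..int m}" "\<And>e. e \<in> E \<Longrightarrow> N e \<inter> ?Z \<noteq> {} \<Longrightarrow> proper \<rho> ?Z e"
      using less.hyps[of ?Z] cl Z(1) by blast
    have "proper \<rho> Z e" if e: "e \<in> E" "N e \<inter> Z \<noteq> {}" for e
    proof -
      have "N e \<inter> ?Z \<noteq> {}"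
      proof
        assume "N e \<inter> ?Z = {}"
        then have "N e \<inter> Z = {v}" using e(2) by auto
        then show False using Z(2) e(1) unfolding closed_def by (metis is_singletonI is_singleton_altdef)
      qed
      from \<rho>(2)[OF e(1) this] show ?thesis by (rule proper_mono) auto
    qed
    then show ?thesis using \<rho>(1) by blast
  next
    case 2
    obtain e1 e2 where e1: "e1 \<in> E" "N e1 \<inter> Z = {u, v}" "u \<noteq> v"
      and e2: "e2 \<in> E" "N e2 \<inter> Z = {w, v}" "w \<noteq> v" using 2(1,2) unfolding nb_def by blast
    obtain Z' where Z': "Z' \<subset> Z" "closed E Z'"
      and re: "\<And>\<rho>\<^sub>0. \<exists>\<rho>. (\<forall>e. e \<notin> E \<or> N e \<inter> Z' \<noteq> {} \<longrightarrow> \<rho> e = \<rho>\<^sub>0 e) \<and>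
        (\<forall>e. \<rho> e = \<rho>\<^sub>0 e \<or> \<rho> e \<in> {1..5}) \<and>
        (\<forall>e\<in>E. N e \<inter> Z \<noteq> {} \<longrightarrow> N e \<inter> Z' = {} \<longrightarrow> proper \<rho> Z e)"
      by (rule leaf_step[OF finZ Z(2) subset_refl e1 e2 2(3)]) (rule that)
    have "card Z' < card Z" using Z'(1) finZ by (simp add: psubset_card_mono)
    moreover have "Z' \<subseteq> R" using Z'(1) Z(1) by blast
    ultimately obtain \<rho>\<^sub>0 where \<rho>0: "\<And>e. \<rho>\<^sub>0 e \<in> {1..int m}"
      "\<And>e. e \<in> E \<Longrightarrow> N e \<inter> Z' \<noteq> {} \<Longrightarrow> proper \<rho>\<^sub>0 Z' e" using less.hyps[of Z'] Z'(2) by blast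
    obtain \<rho> where \<rho>: "\<And>e. N e \<inter> Z' \<noteq> {} \<Longrightarrow> \<rho> e = \<rho>\<^sub>0 e" "\<And>e. \<rho> e = \<rho>\<^sub>0 e \<or> \<rho> e \<in> {1..5}"
      "\<And>e. e \<in> E \<Longrightarrow> N e \<inter> Z \<noteq> {} \<Longrightarrow> N e \<inter> Z' = {} \<Longrightarrow> proper \<rho> Z e" using re[of \<rho>\<^sub>0] by blast
    have same: "W \<rho> v = W \<rho>\<^sub>0 v" if "v \<in> Z'" for v
      by (rule W_cong, rule \<rho>(1)) (use that in auto)
    have "proper \<rho> Z e" if e: "e \<in> E" "N e \<inter> Z \<noteq> {}" for e
    proof (cases "N e \<inter> Z' = {}")
      case True then show ?thesis using \<rho>(3) e by blast
    next
      case False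
      then have "proper \<rho> Z' e" using \<rho>0(2) e proper_cong[of Z' \<rho> \<rho>\<^sub>0] same by blast
      then show ?thesis by (rule proper_mono) (use Z' in auto)
    qed
    moreover have "\<rho> e \<in> {1..int m}" for e using \<rho>(2)[of e] \<rho>0(1)[of e] m5 by auto
    ultimately show ?thesis by blast
  next
    case 3
    \<comment> \<open>Being neighbours is symmetric, so the unique neighbour gives an involution
      without fixed points.\<close>
    define \<pi> where "\<pi> v = (THE u. nb v u)" for v
    have nb: "nb v (\<pi> v)" if "v \<in> Z" for v unfolding \<pi>_def by (rule theI'[OF 3[OF that]])
    have nb_eq: "\<pi> v = u" if "v \<in> Z" "nb v u" for v u using 3[OF that(1)] nb[OF that(1)] that(2) by blast
    have nb_sym: "nb u v" if "nb v u" for u v using that unfolding nb_def by (metis insert_commute)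
    have nb_Z: "u \<in> Z" if "nb v u" for u v using that unfolding nb_def by blast
    interpret matched R E N m Z \<pi>
    proof
      fix x assume x: "x \<in> Z"
      show "\<pi> x \<in> Z" by (rule nb_Z[OF nb[OF x]])
      then show "\<pi> (\<pi> x) = x" by (rule nb_eq) (rule nb_sym[OF nb[OF x]])
      show "\<pi> x \<noteq> x" "\<exists>e\<in>E. N e \<inter> Z = {x, \<pi> x}" using nb[OF x] unfolding nb_def by (auto simp: insert_commute)
    qed (rule Z)+
    show ?thesis by (rule exists_proper_weighting_matched)
  qed
qed

end

section \<open>From a hypergraph to representatives of its twin classes\<close>

theorem theorem8:
  fixes r :: nat and H :: "('v, 'e) hypergraph"
  assumes "r \<ge> 2"
    and "finite_hypergraph H"
    and "\<forall>e\<in>edges H. card (ends H e) \<le> r"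
    and "\<forall>e\<in>edges H. \<not> twin_set H (ends H e)"
  shows "\<exists>\<rho> :: 'e \<Rightarrow> nat.
           (\<forall>e\<in>edges H. \<rho> e \<in> {1..max 5 (r + 1)}) \<and>
           properly_colors H (vertex_weight H \<rho>)"
proof -
  have hyp: "is_hypergraph H" and fin: "finite (verts H)" "finite (edges H)"
    using assms(2) unfolding finite_hypergraph_def by auto
  have ends: "ends H e \<subseteq> verts H" if "e \<in> edges H" for e
    using hyp that unfolding is_hypergraph_def by blast
  \<comment> \<open>The choice depends on \<open>v\<close> only through its incident edges, so twins
    get the same representative.\<close>
  define rep where "rep v = (SOME u. u \<in> verts H \<and> incident_edges H u = incident_edges H v)" for v
  have rep: "rep v \<in> verts H" "incident_edges H (rep v) = incident_edges H v" if "v \<in> verts H" for v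
  proof -
    have "\<exists>u. u \<in> verts H \<and> incident_edges H u = incident_edges H v" using that by blast
    from someI_ex[OF this] show "rep v \<in> verts H" "incident_edges H (rep v) = incident_edges H v"
      unfolding rep_def by auto
  qed
  have rep_eq: "rep u = rep v" if "incident_edges H u = incident_edges H v" for u v
    using that unfolding rep_def by simp
  define R where "R = rep ` verts H"
  define N where "N e = ends H e \<inter> R" for e
  have rep_N: "rep v \<in> N e" if "e \<in> edges H" "v \<in> ends H e" for e v
  proof -
    have v: "v \<in> verts H" using ends that by blast
    have "e \<in> incident_edges H (rep v)" using rep(2)[OF v] that unfolding incident_edges_def by auto
    then show ?thesis using v unfolding N_def R_def incident_edges_def by auto
  qed
  have distinct_reps: "incident_edges H u \<noteq> incident_edges H v" if "u \<in> R" "v \<in> R" "u \<noteq> v" for u v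
    using that rep rep_eq unfolding R_def by (metis (no_types, lifting) imageE)
  interpret twin_free R "edges H" N "max 5 (r + 1)"
  proof
    show "finite R" unfolding R_def using fin(1) by simp
    show "card (N e) < max 5 (r + 1)" if "e \<in> edges H" for e
    proof -
      have "finite (ends H e)" using finite_subset[OF ends[OF that] fin(1)] .
      then have "card (N e) \<le> card (ends H e)" unfolding N_def by (rule card_mono) auto
      then show ?thesis using assms(3) that by fastforce
    qed
    show "\<exists>e\<in>edges H. (u \<in> N e) \<noteq> (v \<in> N e)" if uv: "u \<in> R" "v \<in> R" "u \<noteq> v" for u v
    proof -
      obtain e where "e \<in> edges H" "(u \<in> ends H e) \<noteq> (v \<in> ends H e)"
        using distinct_reps[OF uv] unfolding incident_edges_def by blast
      then show ?thesis using uv unfolding N_def by blast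
    qed
  qed (use fin in \<open>auto simp: N_def\<close>)
  \<comment> \<open>If the trace of an edge has size 1, all its vertices share a representative, so
    the edge would be a twin set.\<close>
  have "closed (edges H) R" unfolding closed_def
  proof
    fix e assume e: "e \<in> edges H"
    show "card (N e \<inter> R) \<noteq> 1"
    proof
      assume "card (N e \<inter> R) = 1"
      then obtain u where "N e \<inter> R = {u}" by (auto simp: card_1_singleton_iff)
      then have "N e = {u}" unfolding N_def by auto
      then have "rep v = u" if "v \<in> ends H e" for v using rep_N[OF e that] by simp
      then have "incident_edges H v = incident_edges H u" if "v \<in> ends H e" for v
        using rep(2)[of v] ends[OF e] that by blast
      then have "twin_set H (ends H e)" unfolding twin_set_def using ends[OF e] by simp
      then show False using assms(4) e by blast
    qed
  qed
  from exists_proper_weighting[OF subset_refl this] obtain \<rho>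
    where \<rho>: "\<And>e. \<rho> e \<in> {1..int (max 5 (r + 1))}"
      "\<And>e. e \<in> edges H \<Longrightarrow> N e \<inter> R \<noteq> {} \<Longrightarrow> proper \<rho> R e" by blast
  define \<sigma> where "\<sigma> e = nat (\<rho> e)" for e
  have \<sigma>: "int (\<sigma> e) = \<rho> e" for e using \<rho>(1)[of e] unfolding \<sigma>_def by simp
  have "\<sigma> e \<in> {1..max 5 (r + 1)}" for e
  proof -
    have "1 \<le> int (\<sigma> e)" "int (\<sigma> e) \<le> int (max 5 (r + 1))" using \<rho>(1)[of e] unfolding \<sigma> by auto
    then show ?thesis by (metis atLeastAtMost_iff of_nat_1 of_nat_le_iff)
  qed
  moreover have weight: "int (vertex_weight H \<sigma> v) = W \<rho> v" if "v \<in> R" for v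
  proof -
    have "incident_edges H v = {e \<in> edges H. v \<in> N e}" using that unfolding incident_edges_def N_def by auto
    then show ?thesis unfolding vertex_weight_def W_def by (simp add: \<sigma>)
  qed
  have "properly_colors H (vertex_weight H \<sigma>)" unfolding properly_colors_def
  proof
    fix e assume e: "e \<in> edges H"
    \<comment> \<open>The empty set is a twin set, so the edge has a vertex, and the representative
      of that vertex lies in the trace.\<close>
    have "ends H e \<noteq> {}" using assms(4) e unfolding twin_set_def by auto
    then have "N e \<inter> R \<noteq> {}" using rep_N[OF e] unfolding N_def by auto
    then obtain u v where uv: "u \<in> N e \<inter> R" "v \<in> N e \<inter> R" "W \<rho> u \<noteq> W \<rho> v"
      using \<rho>(2)[OF e] unfolding proper_def by blast
    then have "vertex_weight H \<sigma> u \<noteq> vertex_weight H \<sigma> v" using weight[of u] weight[of v] by auto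
    then show "\<exists>u\<in>ends H e. \<exists>v\<in>ends H e. vertex_weight H \<sigma> u \<noteq> vertex_weight H \<sigma> v"
      using uv unfolding N_def by blast
  qed
  ultimately show ?thesis by blast
qed

end
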